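(* For every $k\in\mathbb{N}$ and every $\phi\in\operatorname{Hom}^+(\mathcal{A}^0,\mathbb{R})$ (where $\mathcal{A}^0$ is the flag algebra of unlabelled tournaments), we have $$\phi(\mathrm{Tr}_k)\ \geq\ \frac{k!}{2^{\binom{k}{2}}}.$$ Furthermore, for any fixed $k\geq 4$, the equality $\phi(\mathrm{Tr}_k)=k!/2^{\binom{k}{2}}$ holds if and only if $\phi$ is the quasi-random homomorphism $\phi_{\mathrm{qr}}$.
   Context: A tournament is a finite set $V(T)$ together with, for each pair of distinct vertices $u,v$, exactly one of the arcs $\langle u,v\rangle$ (''$u$ beats $v$''), $\langle v,u\rangle$. $\mathrm{Tr}_k$ denotes the transitive tournament on $k$ vertices (isomorphic to $\{1,\dots,k\}$ with $\langle i,j\rangle$ an arc iff $i<j$); $\mathrm{Tr}_0$ is the empty tournament. Here $\mathbb{N}$ includes $0$. Flag algebra $\mathcal{A}^0$. Let $\mathcal{F}^0$ be the set of isomorphism classes of finite tournaments and $\mathcal{F}^0_\ell$ those with $\ell$ vertices. For $T\in\mathcal{F}^0_\ell$ and a tournament $N$ with at least $\ell$ vertices, $p(T,N)$ is the probability that a uniformly random $\ell$-element subset of $V(N)$ induces a tournament isomorphic to $T$. For $T_i\in\mathcal{F}^0_{\ell_i}$ ($i=1,2$) and $N$ with at least $\ell_1+\ell_2$ vertices, $p(T_1,T_2;N)$ is the probability that a uniformly random pair of disjoint subsets of $V(N)$ of sizes $\ell_1,\ell_2$ induces tournaments isomorphic to $T_1$ and $T_2$, respectively. $\mathcal{A}^0$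 is the quotient of the real vector space with basis $\mathcal{F}^0$ by the subspace spanned by all elements $T-\sum_{N\in\mathcal{F}^0_m}p(T,N)N$ with $T\in\mathcal{F}^0_\ell$, $m\geq \ell$. It is a commutative algebra with product induced by $T_1\cdot T_2=\sum_{N\in\mathcal{F}^0_m}p(T_1,T_2;N)N$ for any $m\geq\ell_1+\ell_2$ (well defined in the quotient), whose unit is the empty tournament. $\operatorname{Hom}^+(\mathcal{A}^0,\mathbb{R})$ is the set of unital real algebra homomorphisms $\phi:\mathcal{A}^0\to\mathbb{R}$ with $\phi(T)\geq 0$ for every $T\in\mathcal{F}^0$. (Equivalently, these are exactly the functionals $\phi(T)=\lim_{n\to\infty}p(T,T_n)$ for sequences $\{T_n\}$ of tournaments with $|V(T_n)|\to\infty$ for which all these limits exist.) The quasi-random homomorphism $\phi_{\mathrm{qr}}\in\operatorname{Hom}^+(\mathcal{A}^0,\mathbb{R})$ is the almost sure limit of uniformly random tournaments (each arc orientation picked independently with probability $1/2$) as the number of vertices goes to infinity; explicitly, $\phi_{\mathrm{qr}}(T)=\dfrac{|V(T)|!}{|\operatorname{Aut}(T)|\cdot 2^{\binom{|V(T)|}{2}}}$ for every tournament $T$, where $\operatorname{Aut}(T)$ is the automorphism group of $T$. *)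

theory Defs
  imports "HOL-Analysis.Analysis" "HOL-Analysis.Finite_Function_Topology"
begin

section \<open>Tournaments and their isomorphism classes\<close>

text \<open>\<^term>\<open>(u, v) \<in> A\<close> reads: \<open>u\<close> beats \<open>v\<close>. Asymmetry (which excludes loops) and
  totality say that exactly one of the two arcs is present for each pair of distinct vertices.\<close>

definition tournament :: "'a set \<Rightarrow> ('a \<times> 'a) set \<Rightarrow> bool" where
  "tournament V A \<longleftrightarrow> finite V \<and> A \<subseteq> V \<times> V \<and> asym A \<and> total_on V A"

lemma tournament_alt:
  "tournament V A \<longleftrightarrow> finite V \<and> A \<subseteq> V \<times> V \<and> (\<forall>u v. (u, v) \<in> A \<longrightarrow> (v, u) \<notin> A) \<and>
     (\<forall>u\<in>V. \<forall>v\<in>V. u \<noteq> v \<longrightarrow> (u, v) \<in> A \<or> (v, u) \<in> A)"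
  by (simp add: tournament_def asym_iff total_on_def)

definition tournament_iso ::
    "('a \<Rightarrow> 'b) \<Rightarrow> 'a set \<times> ('a \<times> 'a) set \<Rightarrow> 'b set \<times> ('b \<times> 'b) set \<Rightarrow> bool" where
  "tournament_iso f = (\<lambda>(V, A) (W, B).
     bij_betw f V W \<and> (\<forall>u\<in>V. \<forall>v\<in>V. (u, v) \<in> A \<longleftrightarrow> (f u, f v) \<in> B))"

definition isomorphic_tournaments ::
    "nat set \<times> (nat \<times> nat) set \<Rightarrow> nat set \<times> (nat \<times> nat) set \<Rightarrow> bool" where
  "isomorphic_tournaments G H \<longleftrightarrow>
     case_prod tournament G \<and> case_prod tournament H \<and> (\<exists>f. tournament_iso f G H)"

lemma tournament_iso_sym:
  assumes "tournament_iso f (V, A) (W, B)"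
  shows "tournament_iso (inv_into V f) (W, B) (V, A)"
proof -
  have b: "bij_betw f V W" and e: "\<And>u v. u \<in> V \<Longrightarrow> v \<in> V \<Longrightarrow> (u, v) \<in> A \<longleftrightarrow> (f u, f v) \<in> B"
    using assms by (auto simp: tournament_iso_def)
  have "(u, v) \<in> B \<longleftrightarrow> (inv_into V f u, inv_into V f v) \<in> A" if "u \<in> W" "v \<in> W" for u v
    using e[of "inv_into V f u" "inv_into V f v"] that b
    by (metis bij_betw_def bij_betw_inv_into_right inv_into_into)
  then show ?thesis
    using b by (auto simp: tournament_iso_def bij_betw_inv_into)
qed

lemma tournament_iso_trans:
  assumes "tournament_iso f (V, A) (W, B)" "tournament_iso g (W, B) (U, C)"
  shows "tournament_iso (g \<circ> f) (V, A) (U, C)"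
  using assms by (auto simp: tournament_iso_def bij_betw_trans bij_betw_apply)

lemma tournament_iso_id: "tournament_iso id (V, A) (V, A)"
  by (auto simp: tournament_iso_def)

text \<open>The set of isomorphism classes of finite tournaments. Every finite tournament is isomorphic
  to one whose vertices are natural numbers.\<close>

quotient_type tclass = "nat set \<times> (nat \<times> nat) set" / partial: isomorphic_tournaments
proof (rule part_equivpI)
  have "isomorphic_tournaments ({}, {}) ({}, {})"
    by (auto simp: isomorphic_tournaments_def tournament_alt tournament_iso_def bij_betw_def)
  then show "\<exists>x. isomorphic_tournaments x x" by blast
  show "symp isomorphic_tournaments"
    by (auto simp: symp_def isomorphic_tournaments_def dest: tournament_iso_sym)
  show "transp isomorphic_tournaments"
    by (auto simp: transp_def isomorphic_tournaments_def dest: tournament_iso_trans)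
qed

definition tclass_of :: "nat set \<Rightarrow> (nat \<times> nat) set \<Rightarrow> tclass" where
  "tclass_of V A = abs_tclass (V, A)"

lemma tclass_of_eq_iff:
  assumes "tournament V A" "tournament W B"
  shows "tclass_of V A = tclass_of W B \<longleftrightarrow> (\<exists>f. tournament_iso f (V, A) (W, B))"
proof -
  have "isomorphic_tournaments (V, A) (V, A)" "isomorphic_tournaments (W, B) (W, B)"
    using assms tournament_iso_id by (auto simp: isomorphic_tournaments_def)
  then show ?thesis
    using Quotient3_rel[OF Quotient3_tclass, of "(V, A)" "(W, B)"] assms
    by (auto simp: tclass_of_def isomorphic_tournaments_def)
qed

lemma tclass_cases:
  obtains V A where "tournament V A" "T = tclass_of V A"
proof -
  obtain V A where r: "rep_tclass T = (V, A)" by (cases "rep_tclass T")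
  have "isomorphic_tournaments (rep_tclass T) (rep_tclass T)"
    using Quotient3_rep_reflp[OF Quotient3_tclass] .
  then have "tournament V A" by (simp add: r isomorphic_tournaments_def)
  moreover have "T = tclass_of V A"
    using Quotient3_abs_rep[OF Quotient3_tclass, of T] by (simp add: tclass_of_def r)
  ultimately show thesis by (rule that)
qed

lemma tournament_Restr:
  assumes "tournament V A" "S \<subseteq> V"
  shows "tournament S (Restr A S)"
  using assms
  using finite_subset[of S V] by (auto simp: tournament_alt) (meson subsetD)+

lemma tournament_iso_Restr:
  assumes "tournament_iso f (V, A) (W, B)" "S \<subseteq> V"
  shows "tournament_iso f (S, Restr A S) (f ` S, Restr B (f ` S))"
proof -
  have "inj_on f S" using assms by (auto simp: tournament_iso_def bij_betw_def inj_on_subset)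
  then show ?thesis
    using assms by (auto simp: tournament_iso_def bij_betw_def subset_iff)
qed

lemma tclass_of_Restr_iso:
  assumes "tournament V A" "tournament W B" "tournament_iso f (V, A) (W, B)" "S \<subseteq> V"
  shows "tclass_of (f ` S) (Restr B (f ` S)) = tclass_of S (Restr A S)"
proof -
  have "f ` S \<subseteq> W" using assms by (auto simp: tournament_iso_def bij_betw_def)
  then show ?thesis
    using tournament_iso_Restr[OF assms(3,4)] tclass_of_eq_iff
      tournament_Restr[OF assms(1,4)] tournament_Restr[OF assms(2)] by metis
qed

lift_definition num_verts :: "tclass \<Rightarrow> nat" is "\<lambda>(V, A). card V"
  by (auto simp: isomorphic_tournaments_def tournament_iso_def bij_betw_same_card)

lemma num_verts_tclass_of: "tournament V A \<Longrightarrow> num_verts (tclass_of V A) = card V"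
  unfolding tclass_of_def
  by (subst num_verts.abs_eq) (auto simp: isomorphic_tournaments_def intro: tournament_iso_id)

text \<open>Extensionality fixes the values outside the vertex set, so that isomorphisms are counted
  as maps on the vertex set.\<close>

definition tournament_isos ::
    "'a set \<times> ('a \<times> 'a) set \<Rightarrow> 'b set \<times> ('b \<times> 'b) set \<Rightarrow> ('a \<Rightarrow> 'b) set" where
  "tournament_isos G H = {f \<in> extensional (fst G). tournament_iso f G H}"

lemma tournament_iso_restrict [simp]:
  "tournament_iso (restrict f V) (V, A) H \<longleftrightarrow> tournament_iso f (V, A) H"
  using bij_betw_cong[of V "restrict f V" f] by (cases H) (simp add: tournament_iso_def)

lemma restrict_comp_cancel:
  assumes f: "f \<in> tournament_isos (V, A) (W, B)" and k: "\<And>w. w \<in> W \<Longrightarrow> k' (k w) = w"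
  shows "restrict (k' \<circ> restrict (k \<circ> f) V) V = f"
proof
  fix x
  have "f x \<in> W" if "x \<in> V"
    using that f by (auto simp: tournament_isos_def tournament_iso_def bij_betw_def)
  moreover have "f \<in> extensional V"
    using f by (simp add: tournament_isos_def)
  ultimately show "restrict (k' \<circ> restrict (k \<circ> f) V) V x = f x"
    using k[of "f x"] extensional_arb[of f V x] by (cases "x \<in> V") simp_all
qed

lemma card_tournament_isos_right:
  assumes g: "tournament_iso g (W, B) (U, C)"
  shows "card (tournament_isos (V, A) (W, B)) = card (tournament_isos (V, A) (U, C))"
proof (rule bij_betw_same_card)
  let ?h = "inv_into W g"
  have h: "tournament_iso ?h (U, C) (W, B)"
    by (rule tournament_iso_sym[OF g])
  have gh: "g (?h w) = w" if "w \<in> U" for w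
    using g that by (auto simp: tournament_iso_def bij_betw_inv_into_right)
  have hg: "?h (g w) = w" if "w \<in> W" for w
    using g that by (auto simp: tournament_iso_def bij_betw_inv_into_left)
  show "bij_betw (\<lambda>f. restrict (g \<circ> f) V)
      (tournament_isos (V, A) (W, B)) (tournament_isos (V, A) (U, C))"
  proof (rule bij_betw_byWitness[where f' = "\<lambda>f. restrict (?h \<circ> f) V"])
    show "\<forall>f\<in>tournament_isos (V, A) (W, B). restrict (?h \<circ> restrict (g \<circ> f) V) V = f"
      by (intro ballI restrict_comp_cancel[where W = W and B = B and k = g] hg)
    show "\<forall>f\<in>tournament_isos (V, A) (U, C). restrict (g \<circ> restrict (?h \<circ> f) V) V = f"
      by (intro ballI restrict_comp_cancel[where W = U and B = C and k = ?h] gh)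
    show "(\<lambda>f. restrict (g \<circ> f) V) ` tournament_isos (V, A) (W, B) \<subseteq> tournament_isos (V, A) (U, C)"
      using tournament_iso_trans[OF _ g] by (auto simp: tournament_isos_def)
    show "(\<lambda>f. restrict (?h \<circ> f) V) ` tournament_isos (V, A) (U, C) \<subseteq> tournament_isos (V, A) (W, B)"
      using tournament_iso_trans[OF _ h] by (auto simp: tournament_isos_def)
  qed
qed

lemma restrict_inv_into_cancel:
  assumes b: "bij_betw f V W" and e: "f \<in> extensional V"
  shows "restrict (inv_into W (restrict (inv_into V f) W)) V = f"
proof
  fix x
  let ?g = "restrict (inv_into V f) W"
  have g: "bij_betw ?g W V"
    using bij_betw_inv_into[OF b] bij_betw_cong[of W ?g "inv_into V f" V] by simp
  show "restrict (inv_into W ?g) V x = f x"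
  proof (cases "x \<in> V")
    case True
    then have "?g (f x) = x" and "f x \<in> W"
      using b by (auto simp: bij_betw_inv_into_left bij_betw_def)
    then show ?thesis
      using bij_betw_inv_into_left[OF g, of "f x"] True by simp
  qed (use extensional_arb[OF e, of x] in simp)
qed

lemma card_tournament_isos_sym:
  "card (tournament_isos (V, A) (W, B)) = card (tournament_isos (W, B) (V, A))"
proof (rule bij_betw_same_card)
  show "bij_betw (\<lambda>f. restrict (inv_into V f) W)
      (tournament_isos (V, A) (W, B)) (tournament_isos (W, B) (V, A))"
  proof (rule bij_betw_byWitness[where f' = "\<lambda>f. restrict (inv_into W f) V"])
    show "\<forall>f\<in>tournament_isos (V, A) (W, B). restrict (inv_into W (restrict (inv_into V f) W)) V = f"
      by (intro ballI restrict_inv_into_cancel) (auto simp: tournament_isos_def tournament_iso_def)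
    show "\<forall>f\<in>tournament_isos (W, B) (V, A). restrict (inv_into V (restrict (inv_into W f) V)) W = f"
      by (intro ballI restrict_inv_into_cancel) (auto simp: tournament_isos_def tournament_iso_def)
    show "(\<lambda>f. restrict (inv_into V f) W) ` tournament_isos (V, A) (W, B) \<subseteq> tournament_isos (W, B) (V, A)"
      using tournament_iso_sym[of _ V A W B] by (auto simp: tournament_isos_def)
    show "(\<lambda>f. restrict (inv_into W f) V) ` tournament_isos (W, B) (V, A) \<subseteq> tournament_isos (V, A) (W, B)"
      using tournament_iso_sym[of _ W B V A] by (auto simp: tournament_isos_def)
  qed
qed

text \<open>\<open>|Aut(T)|\<close>\<close>

lift_definition num_auts :: "tclass \<Rightarrow> nat" is "\<lambda>G. card (tournament_isos G G)"
proof -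
  fix G H assume "isomorphic_tournaments G H"
  moreover obtain V A W B where GH: "G = (V, A)" "H = (W, B)" by (cases G, cases H)
  ultimately obtain f where f: "tournament_iso f (V, A) (W, B)"
    by (auto simp: isomorphic_tournaments_def)
  show "card (tournament_isos G G) = card (tournament_isos H H)"
    unfolding GH using card_tournament_isos_right[OF f] card_tournament_isos_sym[of V A W B] by metis
qed

definition empty_tclass :: tclass where
  "empty_tclass = tclass_of {} {}"

definition transitive_tclass :: "nat \<Rightarrow> tclass" where
  "transitive_tclass k = tclass_of {1..k} {(i, j). i \<in> {1..k} \<and> j \<in> {1..k} \<and> i < j}"

text \<open>\<open>F\<^sup>0\<^sub>l\<close>\<close>

definition tclasses :: "nat \<Rightarrow> tclass set" where
  "tclasses l = {T. num_verts T = l}"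

lemma tournament_transitive:
  "tournament {1..k} {(i, j). i \<in> {1..k} \<and> j \<in> {1..k} \<and> i < j}" for k :: nat
  by (auto simp: tournament_alt)

lemma num_verts_transitive: "num_verts (transitive_tclass k) = k"
  unfolding transitive_tclass_def by (simp only: num_verts_tclass_of[OF tournament_transitive] card_atLeastAtMost diff_Suc_1)

lemma tournament_empty: "tournament {} {}"
  by (simp add: tournament_alt)

lemma num_verts_empty: "num_verts empty_tclass = 0"
  by (simp add: empty_tclass_def num_verts_tclass_of tournament_empty)

lemma tclasses_0: "tclasses 0 = {empty_tclass}"
proof -
  have "T = empty_tclass" if 0: "num_verts T = 0" for T
  proof -
    obtain V A where VA: "tournament V A" "T = tclass_of V A" by (rule tclass_cases)
    then have "V = {}" using 0 by (simp add: num_verts_tclass_of tournament_def)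
    then show ?thesis using VA by (simp add: tournament_def empty_tclass_def)
  qed
  then show ?thesis by (auto simp: tclasses_def num_verts_empty)
qed

lemma num_verts_eq_0_iff: "num_verts T = 0 \<longleftrightarrow> T = empty_tclass"
  using tclasses_0 by (auto simp: tclasses_def)

lemma tclass_on:
  assumes "finite X" "card X = num_verts T"
  obtains A where "tournament X A" "T = tclass_of X A"
proof -
  obtain V B where VB: "tournament V B" "T = tclass_of V B" by (rule tclass_cases)
  then have "card V = card X" "finite V"
    using assms by (auto simp: num_verts_tclass_of tournament_alt)
  then obtain f where f: "bij_betw f X V"
    using assms(1) by (metis finite_same_card_bij)
  define A where "A = {(u, v) \<in> X \<times> X. (f u, f v) \<in> B}"
  have "tournament X A"
    unfolding tournament_alt
  proof (intro conjI allI ballI impI)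
    fix u v assume "(u, v) \<in> A"
    then show "(v, u) \<notin> A"
      using VB(1) by (auto simp: A_def tournament_def asym_iff)
  next
    fix u v assume "u \<in> X" "v \<in> X" "u \<noteq> v"
    moreover from this have "f u \<in> V" "f v \<in> V" "f u \<noteq> f v"
      using f by (auto simp: bij_betw_def inj_on_eq_iff)
    ultimately show "(u, v) \<in> A \<or> (v, u) \<in> A"
      using VB(1) by (auto simp: A_def tournament_def total_on_def)
  qed (use assms(1) in \<open>auto simp: A_def\<close>)
  moreover have "tournament_iso f (X, A) (V, B)"
    using f by (auto simp: tournament_iso_def A_def)
  ultimately show thesis
    using that[of A] VB tclass_of_eq_iff[of X A V B] by auto
qed

lemma finite_tclasses: "finite (tclasses l)"
proof (rule finite_subset)
  show "tclasses l \<subseteq> tclass_of {..<l} ` Pow ({..<l} \<times> {..<l})"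
  proof
    fix T assume "T \<in> tclasses l"
    then have "card {..<l} = num_verts T" by (simp add: tclasses_def)
    then obtain A where "tournament {..<l} A" "T = tclass_of {..<l} A"
      using tclass_on[OF finite_lessThan] by blast
    then show "T \<in> tclass_of {..<l} ` Pow ({..<l} \<times> {..<l})"
      unfolding tournament_def by blast
  qed
qed auto

section \<open>Densities\<close>

definition disjoint_subsets :: "'a set \<Rightarrow> nat \<Rightarrow> nat \<Rightarrow> ('a set \<times> 'a set) set" where
  "disjoint_subsets V a b =
     {(X, Y). X \<subseteq> V \<and> Y \<subseteq> V \<and> X \<inter> Y = {} \<and> card X = a \<and> card Y = b}"

text \<open>The isomorphism class of the subtournament induced on \<open>S\<close>.\<close>

definition induced :: "(nat \<times> nat) set \<Rightarrow> nat set \<Rightarrow> tclass" where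
  "induced A S = tclass_of S (Restr A S)"

text \<open>\<^term>\<open>tdensity T N\<close> is \<open>p(T, N)\<close> and \<^term>\<open>tdensity2 T1 T2 N\<close> is \<open>p(T1, T2; N)\<close>; both are
  only meaningful if \<open>N\<close> has sufficiently many vertices, otherwise they are \<open>0 / 0 = 0\<close>.\<close>

lift_definition tdensity :: "tclass \<Rightarrow> tclass \<Rightarrow> real"
  is "\<lambda>T (V, A).
        real (card {S. S \<subseteq> V \<and> card S = num_verts T \<and> induced A S = T})
        / real (card {S. S \<subseteq> V \<and> card S = num_verts T})"
proof -
  fix T and G H :: "nat set \<times> (nat \<times> nat) set"
  assume iso: "isomorphic_tournaments G H"
  obtain V A W B where GH: "G = (V, A)" "H = (W, B)" by (cases G, cases H)
  obtain f where f: "tournament_iso f (V, A) (W, B)" and t: "tournament V A" "tournament W B"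
    using iso by (auto simp: isomorphic_tournaments_def GH)
  have b: "bij_betw f V W" using f by (simp add: tournament_iso_def)
  have pow: "bij_betw ((`) f) (Pow V) (Pow W)" by (rule bij_betw_Pow[OF b])
  have c: "card (f ` S) = card S" if "S \<subseteq> V" for S
    using b that by (meson bij_betw_imp_inj_on card_image inj_on_subset)
  have eq: "card {S. S \<subseteq> V \<and> P S} = card {S. S \<subseteq> W \<and> Q S}"
    if "\<And>S. S \<subseteq> V \<Longrightarrow> Q (f ` S) \<longleftrightarrow> P S" for P Q
    using bij_betw_same_card[OF bij_betw_Collect[OF pow, of Q P]] that by (simp add: Pow_def)
  let ?n = "num_verts T"
  have ind: "induced B (f ` S) = induced A S" if "S \<subseteq> V" for S
    using tclass_of_Restr_iso[OF t f that] by (simp add: induced_def)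
  have "card {S. S \<subseteq> V \<and> card S = ?n \<and> induced A S = T} =
      card {S. S \<subseteq> W \<and> card S = ?n \<and> induced B S = T}"
    by (rule eq) (simp add: c ind)
  moreover have "card {S. S \<subseteq> V \<and> card S = ?n} = card {S. S \<subseteq> W \<and> card S = ?n}"
    by (rule eq) (simp add: c)
  ultimately show "(case G of (V, A) \<Rightarrow>
        real (card {S. S \<subseteq> V \<and> card S = num_verts T \<and> induced A S = T})
        / real (card {S. S \<subseteq> V \<and> card S = num_verts T})) =
      (case H of (V, A) \<Rightarrow>
        real (card {S. S \<subseteq> V \<and> card S = num_verts T \<and> induced A S = T})
        / real (card {S. S \<subseteq> V \<and> card S = num_verts T}))"
    by (simp add: GH)
qed

lift_definition tdensity2 :: "tclass \<Rightarrow> tclass \<Rightarrow> tclass \<Rightarrow> real"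
  is "\<lambda>T1 T2 (V, A).
        real (card {(X, Y) \<in> disjoint_subsets V (num_verts T1) (num_verts T2).
                      induced A X = T1 \<and> induced A Y = T2})
        / real (card (disjoint_subsets V (num_verts T1) (num_verts T2)))"
proof -
  fix T1 T2 and G H :: "nat set \<times> (nat \<times> nat) set"
  assume iso: "isomorphic_tournaments G H"
  obtain V A W B where GH: "G = (V, A)" "H = (W, B)" by (cases G, cases H)
  obtain f where f: "tournament_iso f (V, A) (W, B)" and t: "tournament V A" "tournament W B"
    using iso by (auto simp: isomorphic_tournaments_def GH)
  have b: "bij_betw f V W" using f by (simp add: tournament_iso_def)
  then have inj: "inj_on f V" and im: "f ` V = W" by (auto simp: bij_betw_def)
  let ?d = "\<lambda>V :: nat set. disjoint_subsets V (num_verts T1) (num_verts T2)"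
  have d: "bij_betw (map_prod ((`) f) ((`) f)) (?d V) (?d W)"
    unfolding bij_betw_def
  proof
    have "inj_on ((`) f) (Pow V)"
      using bij_betw_Pow[OF b] by (simp add: bij_betw_def)
    from map_prod_inj_on[OF this this] show "inj_on (map_prod ((`) f) ((`) f)) (?d V)"
      by (rule inj_on_subset) (auto simp: disjoint_subsets_def)
    have dir: "map_prod ((`) g) ((`) g) ` ?d V \<subseteq> ?d W" if "bij_betw g V W" for g V W
    proof -
      have i: "inj_on g V" and m: "g ` V = W" using that by (auto simp: bij_betw_def)
      have c: "card (g ` S) = card S" if "S \<subseteq> V" for S
        using i that by (meson card_image inj_on_subset)
      show ?thesis
      proof (rule image_subsetI)
        fix p assume "p \<in> ?d V"
        then obtain X Y where p: "p = (X, Y)" "X \<subseteq> V" "Y \<subseteq> V" "X \<inter> Y = {}"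
          "card X = num_verts T1" "card Y = num_verts T2"
          by (auto simp: disjoint_subsets_def)
        then have "g ` X \<inter> g ` Y = {}"
          using inj_on_image_Int[OF i p(2,3)] by simp
        then show "map_prod ((`) g) ((`) g) p \<in> ?d W"
          using p c[of X] c[of Y] image_mono[of X V g] image_mono[of Y V g] m
          by (simp add: disjoint_subsets_def)
      qed
    qed
    let ?h = "inv_into V f"
    have "p = map_prod ((`) f) ((`) f) (map_prod ((`) ?h) ((`) ?h) p)" if "p \<in> ?d W" for p
      using that im by (cases p) (auto simp: disjoint_subsets_def image_inv_into_cancel)
    then show "map_prod ((`) f) ((`) f) ` ?d V = ?d W"
      using dir[OF b] dir[OF bij_betw_inv_into[OF b]] by blast
  qed
  let ?P = "\<lambda>A (X, Y). induced A X = T1 \<and> induced A Y = T2"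
  have "?P B (map_prod ((`) f) ((`) f) p) = ?P A p" if "p \<in> ?d V" for p
    using that tclass_of_Restr_iso[OF t f] by (cases p) (auto simp: disjoint_subsets_def induced_def)
  then have "bij_betw (map_prod ((`) f) ((`) f)) {p \<in> ?d V. ?P A p} {p \<in> ?d W. ?P B p}"
    by (rule bij_betw_Collect[OF d])
  then have "card {p \<in> ?d V. ?P A p} = card {p \<in> ?d W. ?P B p}"
    by (rule bij_betw_same_card)
  then show "(case G of (V, A) \<Rightarrow>
        real (card {(X, Y) \<in> ?d V. induced A X = T1 \<and> induced A Y = T2}) / real (card (?d V))) =
      (case H of (V, A) \<Rightarrow>
        real (card {(X, Y) \<in> ?d V. induced A X = T1 \<and> induced A Y = T2}) / real (card (?d V)))"
    using bij_betw_same_card[OF d] by (simp add: GH case_prod_unfold)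
qed

lemma disjoint_subsets_eq_Sigma:
  "disjoint_subsets V a b = (SIGMA X:{X. X \<subseteq> V \<and> card X = a}. {Y. Y \<subseteq> V - X \<and> card Y = b})"
  by (auto simp: disjoint_subsets_def)

lemma finite_disjoint_subsets [simp]: "finite V \<Longrightarrow> finite (disjoint_subsets V a b)"
  unfolding disjoint_subsets_eq_Sigma by (intro finite_SigmaI) auto

lemma card_disjoint_subsets:
  assumes "finite V"
  shows "card (disjoint_subsets V a b) = (card V choose a) * ((card V - a) choose b)"
proof -
  have "card {Y. Y \<subseteq> V - X \<and> card Y = b} = (card V - a) choose b" if "X \<subseteq> V" "card X = a" for X
    using that assms by (simp add: n_subsets card_Diff_subset finite_subset)
  then have "card (disjoint_subsets V a b) =
      (\<Sum>X\<in>{X. X \<subseteq> V \<and> card X = a}. (card V - a) choose b)"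
    unfolding disjoint_subsets_eq_Sigma using assms
    by (subst card_SigmaI) (auto intro!: sum.cong)
  then show ?thesis using assms by (simp add: n_subsets)
qed

lemma card_disjoint_subsets_pos:
  assumes "finite V" "a + b \<le> card V"
  shows "card (disjoint_subsets V a b) > 0"
  using assms by (simp add: card_disjoint_subsets)

lemma tdensity_tclass_of:
  assumes "tournament V A"
  shows "tdensity T (tclass_of V A) =
    real (card {S. S \<subseteq> V \<and> card S = num_verts T \<and> induced A S = T})
        / real (card {S. S \<subseteq> V \<and> card S = num_verts T})"
  using assms unfolding tclass_of_def
  by (subst tdensity.abs_eq) (auto simp: isomorphic_tournaments_def intro: tournament_iso_id)

lemma tdensity2_tclass_of:
  assumes "tournament V A"
  shows "tdensity2 T1 T2 (tclass_of V A) =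
    (\<Sum>(X, Y)\<in>disjoint_subsets V (num_verts T1) (num_verts T2).
       of_bool (induced A X = T1) * of_bool (induced A Y = T2))
    / real (card (disjoint_subsets V (num_verts T1) (num_verts T2)))"
proof -
  let ?D = "disjoint_subsets V (num_verts T1) (num_verts T2)"
  have fin: "finite ?D" using assms by (simp add: tournament_def)
  have "real (card {(X, Y) \<in> ?D. induced A X = T1 \<and> induced A Y = T2}) =
      (\<Sum>p\<in>{p \<in> ?D. case p of (X, Y) \<Rightarrow> induced A X = T1 \<and> induced A Y = T2}. 1)"
    by (simp add: case_prod_unfold)
  also have "\<dots> = (\<Sum>p\<in>?D. if (case p of (X, Y) \<Rightarrow> induced A X = T1 \<and> induced A Y = T2) then 1 else 0)"
    by (rule sum.inter_filter[OF fin])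
  also have "\<dots> = (\<Sum>(X, Y)\<in>?D. of_bool (induced A X = T1) * of_bool (induced A Y = T2))"
    by (intro sum.cong) (auto split: if_splits)
  finally show ?thesis
    using assms unfolding tclass_of_def
    by (subst tdensity2.abs_eq) (auto simp: isomorphic_tournaments_def intro: tournament_iso_id)
qed

lemma num_verts_induced:
  assumes "tournament V A" "S \<subseteq> V"
  shows "num_verts (induced A S) = card S"
  using num_verts_tclass_of[OF tournament_Restr[OF assms]] by (simp add: induced_def)

lemma induced_Restr: "X \<subseteq> S \<Longrightarrow> induced (Restr A S) X = induced A X"
proof -
  assume "X \<subseteq> S"
  then have "Restr (Restr A S) X = Restr A X" by blast
  then show ?thesis by (simp add: induced_def)
qed

lemma induced_empty: "induced A {} = empty_tclass"
  by (simp add: induced_def empty_tclass_def)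

lemma tdensity2_commute: "tdensity2 T1 T2 N = tdensity2 T2 T1 N"
proof -
  obtain V A where VA: "tournament V A" "N = tclass_of V A" by (rule tclass_cases)
  have swap: "bij_betw prod.swap (disjoint_subsets V a b) (disjoint_subsets V b a)" for a b
    by (rule bij_betw_byWitness[where f' = prod.swap]) (auto simp: disjoint_subsets_def)
  show ?thesis
    unfolding VA(2) tdensity2_tclass_of[OF VA(1)] bij_betw_same_card[OF swap]
    by (subst sum.reindex_bij_betw[OF swap, symmetric]) (simp add: case_prod_unfold mult.commute)
qed

definition disjoint_triples :: "'a set \<Rightarrow> nat \<Rightarrow> nat \<Rightarrow> nat \<Rightarrow> ('a set \<times> 'a set \<times> 'a set) set" where
  "disjoint_triples V a b c =
     {(X, Y, Z). (X, Y) \<in> disjoint_subsets V a b \<and> Z \<subseteq> V \<and> (X \<union> Y) \<inter> Z = {} \<and> card Z = c}"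

lemma finite_disjoint_triples [simp]: "finite V \<Longrightarrow> finite (disjoint_triples V a b c)"
  by (rule finite_subset[of _ "Pow V \<times> Pow V \<times> Pow V"])
    (auto simp: disjoint_triples_def disjoint_subsets_def)

lemma card_between:
  assumes "finite V" "U \<subseteq> W" "W \<subseteq> V"
  shows "card {C. U \<subseteq> C \<and> C \<subseteq> W \<and> card C = m} =
    (if card U \<le> m then (card W - card U) choose (m - card U) else 0)"
proof (cases "card U \<le> m")
  case True
  have fin: "finite W" "finite U" using assms by (meson finite_subset)+
  have "card {C. U \<subseteq> C \<and> C \<subseteq> W \<and> card C = m} = card {D. D \<subseteq> W - U \<and> card D = m - card U}"
  proof (rule bij_betw_same_card, rule bij_betw_byWitness[where f' = "\<lambda>D. D \<union> U"])
    have "card (D \<union> U) = m" if "D \<subseteq> W - U" "card D = m - card U" for D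
      using that fin True by (subst card_Un_disjoint) (auto intro: finite_subset)
    then show "(\<lambda>D. D \<union> U) ` {D. D \<subseteq> W - U \<and> card D = m - card U} \<subseteq>
        {C. U \<subseteq> C \<and> C \<subseteq> W \<and> card C = m}"
      using assms(2) by blast
    show "(\<lambda>C. C - U) ` {C. U \<subseteq> C \<and> C \<subseteq> W \<and> card C = m} \<subseteq>
        {D. D \<subseteq> W - U \<and> card D = m - card U}"
      using card_Diff_subset[OF fin(2)] by blast
  qed auto
  then show ?thesis using True fin assms(2) by (simp add: n_subsets card_Diff_subset)
next
  case False
  have "card U \<le> m" if "U \<subseteq> C" "C \<subseteq> W" "card C = m" for C
    using that card_mono[of C U] assms by (meson finite_subset)
  then have "{C. U \<subseteq> C \<and> C \<subseteq> W \<and> card C = m} = {}" using False by blast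
  then show ?thesis using False by (simp only: card.empty if_False)
qed

lemma sum_disjoint_triples:
  fixes h :: "'a set \<Rightarrow> 'a set \<Rightarrow> 'a set \<Rightarrow> real"
  assumes fin: "finite V" and m: "a + b \<le> m"
  shows "(\<Sum>(C, Z)\<in>disjoint_subsets V m c. \<Sum>(X, Y)\<in>disjoint_subsets C a b. h X Y Z) =
    (\<Sum>(X, Y, Z)\<in>disjoint_triples V a b c. h X Y Z)
      * real ((card V - (a + b + c)) choose (m - (a + b)))"
proof -
  let ?L = "SIGMA (C, Z):disjoint_subsets V m c. disjoint_subsets C a b"
  let ?B = "\<lambda>(X, Y, Z). {C. X \<union> Y \<subseteq> C \<and> C \<subseteq> V - Z \<and> card C = m}"
  let ?R = "SIGMA t:disjoint_triples V a b c. ?B t"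
  have finC: "finite (disjoint_subsets C a b)" if "(C, Z) \<in> disjoint_subsets V m c" for C Z
    using that finite_subset[OF _ fin, of C] by (simp add: disjoint_subsets_def[of V])
  have finB: "finite (?B t)" for t
    by (rule finite_subset[of _ "Pow V"]) (use fin in auto)
  have "(\<Sum>(C, Z)\<in>disjoint_subsets V m c. \<Sum>(X, Y)\<in>disjoint_subsets C a b. h X Y Z) =
      (\<Sum>p\<in>disjoint_subsets V m c. \<Sum>q\<in>(case p of (C, Z) \<Rightarrow> disjoint_subsets C a b).
         h (fst q) (snd q) (snd p))"
    by (simp add: case_prod_unfold)
  also have "\<dots> = (\<Sum>(p, q)\<in>?L. h (fst q) (snd q) (snd p))"
    using fin finC by (subst sum.Sigma) auto
  also have "\<dots> = (\<Sum>(t, C)\<in>?R. h (fst t) (fst (snd t)) (snd (snd t)))"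
    by (rule sum.reindex_bij_witness[of _ "\<lambda>((X, Y, Z), C). ((C, Z), (X, Y))"
          "\<lambda>((C, Z), (X, Y)). ((X, Y, Z), C)"])
      (auto simp: disjoint_triples_def disjoint_subsets_def)
  also have "\<dots> = (\<Sum>t\<in>disjoint_triples V a b c. \<Sum>C\<in>?B t. h (fst t) (fst (snd t)) (snd (snd t)))"
    using fin finB by (subst sum.Sigma) auto
  also have "\<dots> = (\<Sum>t\<in>disjoint_triples V a b c. h (fst t) (fst (snd t)) (snd (snd t))
      * real ((card V - (a + b + c)) choose (m - (a + b))))"
  proof (rule sum.cong[OF refl])
    fix t assume "t \<in> disjoint_triples V a b c"
    then obtain X Y Z where t: "t = (X, Y, Z)" and s: "X \<subseteq> V" "Y \<subseteq> V" "Z \<subseteq> V" "X \<inter> Y = {}"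
      "(X \<union> Y) \<inter> Z = {}" "card X = a" "card Y = b" "card Z = c"
      by (auto simp: disjoint_triples_def disjoint_subsets_def)
    have f: "finite X" "finite Y" "finite Z" using s fin by (meson finite_subset)+
    have cXY: "card (X \<union> Y) = a + b" using s f by (simp add: card_Un_disjoint)
    have "X \<union> Y \<subseteq> V - Z" using s by blast
    then have "card (?B t) = (card (V - Z) - (a + b)) choose (m - (a + b))"
      using card_between[OF fin, of "X \<union> Y" "V - Z" m] m by (simp add: t cXY)
    also have "card (V - Z) - (a + b) = card V - (a + b + c)"
      using s f by (simp add: card_Diff_subset)
    finally show "(\<Sum>C\<in>?B t. h (fst t) (fst (snd t)) (snd (snd t))) =
        h (fst t) (fst (snd t)) (snd (snd t)) * real ((card V - (a + b + c)) choose (m - (a + b)))"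
      by simp
  qed
  finally show ?thesis by (simp add: sum_distrib_right case_prod_unfold)
qed

text \<open>The probability that a random triple of disjoint vertex sets of \<open>(V, A)\<close> induces
  the three given tournaments.\<close>

definition tdensity3 :: "tclass \<Rightarrow> tclass \<Rightarrow> tclass \<Rightarrow> nat set \<Rightarrow> (nat \<times> nat) set \<Rightarrow> real" where
  "tdensity3 T1 T2 T3 V A =
    (\<Sum>(X, Y, Z)\<in>disjoint_triples V (num_verts T1) (num_verts T2) (num_verts T3).
       of_bool (induced A X = T1) * of_bool (induced A Y = T2) * of_bool (induced A Z = T3))
    / real (card (disjoint_triples V (num_verts T1) (num_verts T2) (num_verts T3)))"

lemma sum_density2_density2:
  assumes VA: "tournament V A" and m: "num_verts T1 + num_verts T2 \<le> m"
    and n: "m + num_verts T3 \<le> card V"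
  shows "(\<Sum>M\<in>tclasses m. tdensity2 T1 T2 M * tdensity2 M T3 (tclass_of V A)) = tdensity3 T1 T2 T3 V A"
proof -
  let ?a = "num_verts T1" and ?b = "num_verts T2" and ?c = "num_verts T3"
  let ?P = "disjoint_subsets V m ?c" and ?T = "disjoint_triples V ?a ?b ?c"
  let ?K = "real ((card V - (?a + ?b + ?c)) choose (m - (?a + ?b)))"
  let ?N = "real ((m choose ?a) * ((m - ?a) choose ?b))"
  let ?h = "\<lambda>X Y Z. of_bool (induced A X = T1) * of_bool (induced A Y = T2) *
    of_bool (induced A Z = T3) :: real"
  have fin: "finite V" using VA by (simp add: tournament_def)
  have P: "C \<subseteq> V" "card C = m" "finite C" if "(C, Z) \<in> ?P" for C Z
    using that fin by (auto simp: disjoint_subsets_def intro: finite_subset)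
  have d2: "tdensity2 M T3 (tclass_of V A) =
      (\<Sum>(C, Z)\<in>?P. of_bool (induced A C = M) * of_bool (induced A Z = T3)) / real (card ?P)"
    if "M \<in> tclasses m" for M
    using tdensity2_tclass_of[OF VA, of M T3] that by (simp add: tclasses_def)
  have inner: "tdensity2 T1 T2 (induced A C) * of_bool (induced A Z = T3) =
      (\<Sum>(X, Y)\<in>disjoint_subsets C ?a ?b. ?h X Y Z) / ?N" if "(C, Z) \<in> ?P" for C Z
  proof -
    have "induced A C = tclass_of C (Restr A C)" by (simp add: induced_def)
    moreover have "(\<Sum>(X, Y)\<in>disjoint_subsets C ?a ?b.
          of_bool (induced (Restr A C) X = T1) * of_bool (induced (Restr A C) Y = T2)) =
        (\<Sum>(X, Y)\<in>disjoint_subsets C ?a ?b.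
          of_bool (induced A X = T1) * of_bool (induced A Y = T2) :: real)"
      by (rule sum.cong) (auto simp: disjoint_subsets_def induced_Restr)
    ultimately have "tdensity2 T1 T2 (induced A C) = (\<Sum>(X, Y)\<in>disjoint_subsets C ?a ?b.
          of_bool (induced A X = T1) * of_bool (induced A Y = T2)) / ?N"
      using tdensity2_tclass_of[OF tournament_Restr[OF VA P(1)[OF that]]] P[OF that]
      by (simp add: card_disjoint_subsets)
    then show ?thesis
      by (simp add: sum_distrib_right case_prod_unfold sum_divide_distrib)
  qed
  have "(\<Sum>M\<in>tclasses m. tdensity2 T1 T2 M * tdensity2 M T3 (tclass_of V A)) =
      (\<Sum>M\<in>tclasses m. \<Sum>(C, Z)\<in>?P. tdensity2 T1 T2 M *
         (of_bool (induced A C = M) * of_bool (induced A Z = T3))) / real (card ?P)"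
    by (simp add: d2 sum_distrib_left sum_divide_distrib case_prod_unfold)
  also have "(\<Sum>M\<in>tclasses m. \<Sum>(C, Z)\<in>?P. tdensity2 T1 T2 M *
         (of_bool (induced A C = M) * of_bool (induced A Z = T3))) =
      (\<Sum>(C, Z)\<in>?P. \<Sum>M\<in>tclasses m. tdensity2 T1 T2 M *
         (of_bool (induced A C = M) * of_bool (induced A Z = T3)))"
    unfolding case_prod_unfold by (rule sum.swap)
  also have "\<dots> = (\<Sum>(C, Z)\<in>?P. tdensity2 T1 T2 (induced A C) * of_bool (induced A Z = T3))"
  proof (rule sum.cong[OF refl], clarify)
    fix C Z assume "(C, Z) \<in> ?P"
    then have "induced A C \<in> tclasses m"
      using P num_verts_induced[OF VA] by (simp add: tclasses_def)
    have "(\<Sum>M\<in>tclasses m. tdensity2 T1 T2 M *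
         (of_bool (induced A C = M) * of_bool (induced A Z = T3))) =
        (\<Sum>M\<in>tclasses m. if induced A C = M then tdensity2 T1 T2 M * of_bool (induced A Z = T3) else 0)"
      by (rule sum.cong) auto
    also have "\<dots> = tdensity2 T1 T2 (induced A C) * of_bool (induced A Z = T3)"
      using \<open>induced A C \<in> tclasses m\<close> by (subst sum.delta'[OF finite_tclasses]) simp
    finally show "(\<Sum>M\<in>tclasses m. tdensity2 T1 T2 M *
         (of_bool (induced A C = M) * of_bool (induced A Z = T3))) =
        tdensity2 T1 T2 (induced A C) * of_bool (induced A Z = T3)" .
  qed
  also have "\<dots> = (\<Sum>(C, Z)\<in>?P. (\<Sum>(X, Y)\<in>disjoint_subsets C ?a ?b. ?h X Y Z) / ?N)"
    using inner by (intro sum.cong) auto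
  also have "\<dots> = (\<Sum>(C, Z)\<in>?P. \<Sum>(X, Y)\<in>disjoint_subsets C ?a ?b. ?h X Y Z) / ?N"
    by (simp add: sum_divide_distrib case_prod_unfold)
  also have "(\<Sum>(C, Z)\<in>?P. \<Sum>(X, Y)\<in>disjoint_subsets C ?a ?b. ?h X Y Z) =
      (\<Sum>(X, Y, Z)\<in>?T. ?h X Y Z) * ?K"
    by (rule sum_disjoint_triples[OF fin m])
  finally have 1: "(\<Sum>M\<in>tclasses m. tdensity2 T1 T2 M * tdensity2 M T3 (tclass_of V A)) =
      (\<Sum>(X, Y, Z)\<in>?T. ?h X Y Z) * ?K / ?N / real (card ?P)" .
  have "(\<Sum>(C, Z)\<in>?P. \<Sum>(X, Y)\<in>disjoint_subsets C ?a ?b. 1 :: real) =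
      (\<Sum>(C, Z)\<in>?P. ?N)"
    using P by (intro sum.cong) (auto simp: card_disjoint_subsets)
  then have 2: "real (card ?T) * ?K = real (card ?P) * ?N"
    using sum_disjoint_triples[OF fin m, of "\<lambda>_ _ _. 1" ?c] by (simp add: case_prod_unfold)
  have "?N > 0" using m by simp
  moreover have "real (card ?P) > 0" using card_disjoint_subsets_pos[OF fin n] by simp
  ultimately have "real (card ?T) \<noteq> 0" "?K \<noteq> 0" using 2 by (metis mult_eq_0_iff less_irrefl)+
  moreover have "x * k / n / p = x / t" if "t * k = p * n" "t \<noteq> 0" "n > 0" "p > 0" for x k n p t :: real
    using that by (simp add: field_simps)
  ultimately have "x * ?K / ?N / real (card ?P) = x / real (card ?T)" for x
    using 2 \<open>?N > 0\<close> \<open>real (card ?P) > 0\<close> by blast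
  then show ?thesis unfolding 1 tdensity3_def by blast
qed

lemma tdensity3_cycle: "tdensity3 T1 T2 T3 V A = tdensity3 T2 T3 T1 V A"
proof -
  have cyc: "bij_betw (\<lambda>(X, Y, Z). (Y, Z, X)) (disjoint_triples V a b c) (disjoint_triples V b c a)"
    for a b c
    by (rule bij_betw_byWitness[where f' = "\<lambda>(Y, Z, X). (X, Y, Z)"])
      (auto simp: disjoint_triples_def disjoint_subsets_def)
  show ?thesis
    unfolding tdensity3_def
      bij_betw_same_card[OF cyc, of "num_verts T1" "num_verts T2" "num_verts T3"]
      sum.reindex_bij_betw[OF cyc, of _ "num_verts T1" "num_verts T2" "num_verts T3", symmetric]
    by (simp add: case_prod_unfold mult_ac)
qed

lemma tdensity3_empty:
  assumes VA: "tournament V A"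
  shows "tdensity3 T1 T2 empty_tclass V A = tdensity2 T1 T2 (tclass_of V A)"
proof -
  have fin: "finite V" using VA by (simp add: tournament_def)
  have e: "Z = {}" if "Z \<subseteq> V" "card Z = 0" for Z
    using that fin by (auto dest: finite_subset)
  have bij: "bij_betw (\<lambda>(X, Y). (X, Y, {})) (disjoint_subsets V a b) (disjoint_triples V a b 0)" for a b
    by (rule bij_betw_byWitness[where f' = "\<lambda>(X, Y, Z). (X, Y)"])
      (auto simp: disjoint_triples_def dest: e)
  show ?thesis
    unfolding tdensity3_def tdensity2_tclass_of[OF VA] num_verts_empty bij_betw_same_card[OF bij, symmetric]
    by (subst sum.reindex_bij_betw[OF bij, symmetric]) (simp add: case_prod_unfold induced_empty)
qed

lemma tdensity2_empty: "tdensity2 T empty_tclass N = tdensity T N"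
proof -
  obtain V A where VA: "tournament V A" "N = tclass_of V A" by (rule tclass_cases)
  have fin: "finite V" using VA by (simp add: tournament_def)
  have e: "Z = {}" if "Z \<subseteq> V" "card Z = 0" for Z
    using that fin by (auto dest: finite_subset)
  let ?S = "{X. X \<subseteq> V \<and> card X = num_verts T}"
  have finS: "finite ?S" using fin by simp
  have bij: "bij_betw (\<lambda>X. (X, {})) ?S (disjoint_subsets V (num_verts T) 0)"
    by (rule bij_betw_byWitness[where f' = fst]) (auto simp: disjoint_subsets_def dest: e)
  have "(\<Sum>X\<in>?S. of_bool (induced A X = T) :: real) =
      (\<Sum>X\<in>?S. if induced A X = T then 1 else 0)"
    by (rule sum.cong) auto
  also have "\<dots> = real (card {X \<in> ?S. induced A X = T})"
    by (subst sum.inter_filter[OF finS, symmetric]) simp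
  also have "{X \<in> ?S. induced A X = T} = {X. X \<subseteq> V \<and> card X = num_verts T \<and> induced A X = T}"
    by blast
  finally show ?thesis
    unfolding VA(2) tdensity2_tclass_of[OF VA(1)] tdensity_tclass_of[OF VA(1)] num_verts_empty
      bij_betw_same_card[OF bij, symmetric]
    by (subst sum.reindex_bij_betw[OF bij, symmetric]) (simp add: induced_empty)
qed

lemma sum_density2_density:
  assumes "num_verts T1 + num_verts T2 \<le> m" "m \<le> num_verts N"
  shows "(\<Sum>M\<in>tclasses m. tdensity2 T1 T2 M * tdensity M N) = tdensity2 T1 T2 N"
proof -
  obtain V A where VA: "tournament V A" "N = tclass_of V A" by (rule tclass_cases)
  show ?thesis
    using sum_density2_density2[OF VA(1) assms(1), of empty_tclass] assms(2)
    by (simp add: VA tdensity2_empty tdensity3_empty num_verts_empty num_verts_tclass_of)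
qed

lemma sum_density_density2:
  assumes "num_verts T1 \<le> m" "m + num_verts T2 \<le> num_verts N"
  shows "(\<Sum>M\<in>tclasses m. tdensity T1 M * tdensity2 M T2 N) = tdensity2 T1 T2 N"
proof -
  obtain V A where VA: "tournament V A" "N = tclass_of V A" by (rule tclass_cases)
  have "(\<Sum>M\<in>tclasses m. tdensity T1 M * tdensity2 M T2 N) = tdensity3 T1 empty_tclass T2 V A"
    using sum_density2_density2[OF VA(1), of T1 empty_tclass m T2] assms
    by (simp add: VA tdensity2_empty num_verts_empty num_verts_tclass_of)
  also have "\<dots> = tdensity3 T2 T1 empty_tclass V A"
    by (rule tdensity3_cycle[symmetric])
  also have "\<dots> = tdensity2 T1 T2 N"
    by (simp add: VA tdensity3_empty tdensity2_commute)
  finally show ?thesis .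
qed

lemma sum_density2_assoc:
  assumes "num_verts T1 + num_verts T2 + num_verts T3 \<le> num_verts N"
  shows "(\<Sum>M\<in>tclasses (num_verts T1 + num_verts T2). tdensity2 T1 T2 M * tdensity2 M T3 N) =
    (\<Sum>M\<in>tclasses (num_verts T2 + num_verts T3). tdensity2 T2 T3 M * tdensity2 T1 M N)"
proof -
  obtain V A where VA: "tournament V A" "N = tclass_of V A" by (rule tclass_cases)
  have "(\<Sum>M\<in>tclasses (num_verts T1 + num_verts T2). tdensity2 T1 T2 M * tdensity2 M T3 N) =
      tdensity3 T1 T2 T3 V A"
    using sum_density2_density2[OF VA(1) order_refl, of T1 T2 T3] assms
    by (simp add: VA num_verts_tclass_of)
  also have "\<dots> = tdensity3 T2 T3 T1 V A" by (rule tdensity3_cycle)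
  also have "\<dots> = (\<Sum>M\<in>tclasses (num_verts T2 + num_verts T3). tdensity2 T2 T3 M * tdensity2 M T1 N)"
    using sum_density2_density2[OF VA(1) order_refl, of T2 T3 T1] assms
    by (simp add: VA num_verts_tclass_of)
  finally show ?thesis by (simp add: tdensity2_commute)
qed

lemma tdensity_same_size:
  assumes "num_verts T = num_verts N"
  shows "tdensity T N = of_bool (T = N)"
proof -
  obtain V A where VA: "tournament V A" "N = tclass_of V A" by (rule tclass_cases)
  have fin: "finite V" and A: "Restr A V = A" using VA by (auto simp: tournament_def)
  have n: "num_verts T = card V" using assms VA by (simp add: num_verts_tclass_of)
  have sub: "S \<subseteq> V \<and> card S = card V \<longleftrightarrow> S = V" for S
    using card_subset_eq[OF fin] by blast
  have 1: "{S. S \<subseteq> V \<and> card S = num_verts T} = {V}"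
    unfolding n sub by simp
  have "{S. S \<subseteq> V \<and> card S = num_verts T \<and> induced A S = T} = (if T = N then {V} else {})"
  proof -
    have "induced A V = N" by (simp add: induced_def A VA(2))
    moreover have "S \<subseteq> V \<and> card S = num_verts T \<and> induced A S = T \<longleftrightarrow> S = V \<and> induced A V = T" for S
      unfolding n using sub[of S] by blast
    ultimately show ?thesis by auto
  qed
  then show ?thesis
    unfolding VA(2) tdensity_tclass_of[OF VA(1)] 1 by (simp add: VA(2))
qed

section \<open>The number of labelled tournaments in an isomorphism class\<close>

lemma finite_tournaments: "finite X \<Longrightarrow> finite {A. tournament X A}"
  by (rule finite_subset[of _ "Pow (X \<times> X)"]) (auto simp: tournament_def)

lemma card_bijections:
  assumes "finite X" "finite V" "card X = card V"
  shows "card {f \<in> extensional X. bij_betw f X V} = fact (card X)"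
proof -
  have "{f \<in> extensional X. bij_betw f X V} = {f \<in> X \<rightarrow>\<^sub>E V. inj_on f X}"
  proof (intro equalityI subsetI)
    fix f assume "f \<in> {f \<in> X \<rightarrow>\<^sub>E V. inj_on f X}"
    then have f: "f \<in> extensional X" "f ` X \<subseteq> V" "inj_on f X" by (auto simp: PiE_def)
    moreover have "f ` X = V"
      using f card_image[of f X] assms card_subset_eq by metis
    ultimately show "f \<in> {f \<in> extensional X. bij_betw f X V}" by (simp add: bij_betw_def)
  qed (auto simp: bij_betw_def PiE_def)
  moreover have "prod ((-) n) {0..<n} = (fact n :: nat)" for n :: nat
    by (simp add: fact_prod_rev)
  ultimately show ?thesis
    using card_inj_on_subset_funcset[OF assms(1,2) subset_refl] assms(3) by simp
qed

lemma card_labelled: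
  assumes X: "finite X" "card X = num_verts T"
  shows "card {A. tournament X A \<and> tclass_of X A = T} * num_auts T = fact (num_verts T)"
proof -
  let ?L = "{A. tournament X A \<and> tclass_of X A = T}"
  obtain B where B: "tournament X B" "T = tclass_of X B"
    using tclass_on[OF X] by blast
  let ?F = "{f \<in> extensional X. bij_betw f X X}"
  have finL: "finite ?L"
    by (rule finite_subset[OF _ finite_tournaments[OF X(1)]]) auto
  have auts: "num_auts T = card (tournament_isos (X, B) (X, B))"
    unfolding B(2) tclass_of_def using B(1)
    by (subst num_auts.abs_eq) (auto simp: isomorphic_tournaments_def intro: tournament_iso_id)
  have iso: "card (tournament_isos (X, A) (X, B)) = num_auts T" if "A \<in> ?L" for A
  proof -
    have A: "tournament X A" and "tclass_of X B = tclass_of X A" using that B by simp_all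
    then obtain f where "tournament_iso f (X, B) (X, A)"
      using tclass_of_eq_iff[OF B(1) A] by blast
    then show ?thesis
      unfolding auts using card_tournament_isos_right card_tournament_isos_sym by metis
  qed
  have "(\<Union>A\<in>?L. tournament_isos (X, A) (X, B)) = ?F"
  proof (intro equalityI subsetI)
    fix f assume f: "f \<in> ?F"
    then have b: "bij_betw f X X" by simp
    define A where "A = {(u, v) \<in> X \<times> X. (f u, f v) \<in> B}"
    have "tournament X A"
      unfolding tournament_alt
    proof (intro conjI allI ballI impI)
      fix u v assume "(u, v) \<in> A"
      then show "(v, u) \<notin> A"
        using B(1) by (auto simp: A_def tournament_def asym_iff)
    next
      fix u v assume "u \<in> X" "v \<in> X" "u \<noteq> v"
      moreover from this have "f u \<in> X" "f v \<in> X" "f u \<noteq> f v"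
        using b by (auto simp: bij_betw_def inj_on_eq_iff)
      ultimately show "(u, v) \<in> A \<or> (v, u) \<in> A"
        using B(1) by (auto simp: A_def tournament_def total_on_def)
    qed (use X(1) in \<open>auto simp: A_def\<close>)
    moreover have "tournament_iso f (X, A) (X, B)"
      using b by (auto simp: tournament_iso_def A_def)
    ultimately have "A \<in> ?L" "f \<in> tournament_isos (X, A) (X, B)"
      using f B tclass_of_eq_iff[of X A X B] by (auto simp: tournament_isos_def)
    then show "f \<in> (\<Union>A\<in>?L. tournament_isos (X, A) (X, B))" by blast
  qed (auto simp: tournament_isos_def tournament_iso_def)
  moreover have "finite ?F"
    using finite_PiE[OF X(1), of "\<lambda>_. X"] X(1)
    by (rule_tac finite_subset[of _ "X \<rightarrow>\<^sub>E X"]) (auto simp: PiE_def bij_betw_def)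
  moreover have "A = A'" if "A \<in> ?L" "A' \<in> ?L" "f \<in> tournament_isos (X, A) (X, B)"
    "f \<in> tournament_isos (X, A') (X, B)" for A A' f
  proof -
    have "A \<subseteq> X \<times> X" "A' \<subseteq> X \<times> X" using that by (auto simp: tournament_def)
    moreover have "(u, v) \<in> A \<longleftrightarrow> (u, v) \<in> A'" if "u \<in> X" "v \<in> X" for u v
      using that \<open>f \<in> tournament_isos (X, A) (X, B)\<close> \<open>f \<in> tournament_isos (X, A') (X, B)\<close>
      by (simp add: tournament_isos_def tournament_iso_def)
    ultimately show ?thesis
      by (intro set_eqI iffI; rename_tac p; case_tac p) blast+
  qed
  ultimately have "card ?F = (\<Sum>A\<in>?L. card (tournament_isos (X, A) (X, B)))"
    by (subst card_UN_disjoint[OF finL, symmetric]) (auto intro: finite_subset)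
  also have "\<dots> = card ?L * num_auts T" using iso by simp
  finally show ?thesis using card_bijections[OF X(1) X(1) refl] X(2) by simp
qed

lemma num_auts_pos: "num_auts T > 0"
  using card_labelled[of "{..<num_verts T}" T] by (metis card_lessThan fact_nonzero finite_lessThan
      gr0I mult_0_right)

definition cross_pairs :: "nat set \<Rightarrow> nat set \<Rightarrow> nat set \<Rightarrow> (nat \<times> nat) set" where
  "cross_pairs V X Y = {(i, j) \<in> V \<times> V. i < j \<and> (i, j) \<notin> X \<times> X \<and> (i, j) \<notin> Y \<times> Y}"

lemma bij_betw_split_tournaments:
  assumes "finite V" "X \<subseteq> V" "Y \<subseteq> V" "X \<inter> Y = {}"
  shows "bij_betw (\<lambda>A. (Restr A X, Restr A Y, A \<inter> cross_pairs V X Y)) {A. tournament V A}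
    ({A. tournament X A} \<times> {A. tournament Y A} \<times> Pow (cross_pairs V X Y))"
proof (rule bij_betw_byWitness[where f' = "\<lambda>(B, C, D). B \<union> C \<union> D \<union> (cross_pairs V X Y - D)\<inverse>"])
  let ?R = "cross_pairs V X Y"
  let ?f = "\<lambda>A. (Restr A X, Restr A Y, A \<inter> ?R)"
  let ?g = "\<lambda>(B, C, D). B \<union> C \<union> D \<union> (?R - D)\<inverse>"
  show "\<forall>A\<in>{A. tournament V A}. ?g (?f A) = A"
  proof
    fix A assume "A \<in> {A. tournament V A}"
    then have A: "tournament V A" by simp
    have "(u, v) \<in> ?g (?f A) \<longleftrightarrow> (u, v) \<in> A" for u v
    proof (cases "u \<in> V \<and> v \<in> V \<and> u \<noteq> v")
      case False
      then show ?thesis using A assms by (auto simp: tournament_alt cross_pairs_def)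
    next
      case True
      then have "(u, v) \<in> A \<or> (v, u) \<in> A" "(u, v) \<in> A \<longrightarrow> (v, u) \<notin> A"
        using A by (auto simp: tournament_alt)
      moreover have "(u, v) \<in> ?R \<or> (v, u) \<in> ?R \<or> u \<in> X \<and> v \<in> X \<or> u \<in> Y \<and> v \<in> Y"
        using True by (auto simp: cross_pairs_def)
      moreover have "(v, u) \<in> ?R \<longrightarrow> \<not> (u \<in> X \<and> v \<in> X) \<and> \<not> (u \<in> Y \<and> v \<in> Y)"
        by (auto simp: cross_pairs_def)
      moreover have "(u, v) \<in> ?g (?f A) \<longleftrightarrow> (u, v) \<in> A \<and> u \<in> X \<and> v \<in> X \<or>
          (u, v) \<in> A \<and> u \<in> Y \<and> v \<in> Y \<or> (u, v) \<in> A \<and> (u, v) \<in> ?R \<or>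
          (v, u) \<in> ?R \<and> (v, u) \<notin> A"
        by auto
      ultimately show ?thesis by argo
    qed
    from this[of "fst p" "snd p" for p] show "?g (?f A) = A"
      unfolding prod.collapse by (rule set_eqI)
  qed
  show "\<forall>p\<in>{A. tournament X A} \<times> {A. tournament Y A} \<times> Pow ?R. ?f (?g p) = p"
  proof
    fix p assume "p \<in> {A. tournament X A} \<times> {A. tournament Y A} \<times> Pow ?R"
    then obtain B C D where p: "p = (B, C, D)" "tournament X B" "tournament Y C" and D: "D \<subseteq> ?R"
      by blast
    then have B: "B \<subseteq> X \<times> X" and C: "C \<subseteq> Y \<times> Y" by (auto simp: tournament_def)
    have "Restr (?g (B, C, D)) X = B" "Restr (?g (B, C, D)) Y = C"
      using B C D assms(4) by (auto simp: cross_pairs_def)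
    moreover have "?g (B, C, D) \<inter> ?R = D"
      using B C D by (auto simp: cross_pairs_def)
    ultimately show "?f (?g p) = p" unfolding p(1) by blast
  qed
  show "?f ` {A. tournament V A} \<subseteq> {A. tournament X A} \<times> {A. tournament Y A} \<times> Pow ?R"
    using assms tournament_Restr by auto
  show "?g ` ({A. tournament X A} \<times> {A. tournament Y A} \<times> Pow ?R) \<subseteq> {A. tournament V A}"
  proof (rule image_subsetI)
    fix p assume "p \<in> {A. tournament X A} \<times> {A. tournament Y A} \<times> Pow ?R"
    then obtain B C D where p: "p = (B, C, D)" and B: "tournament X B" and C: "tournament Y C"
      and D: "D \<subseteq> ?R"
      by blast
    have BC: "B \<subseteq> X \<times> X" "C \<subseteq> Y \<times> Y" using B C by (auto simp: tournament_def)
    have "tournament V (B \<union> C \<union> D \<union> (?R - D)\<inverse>)"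
      unfolding tournament_alt
    proof (intro conjI allI ballI impI)
      show "B \<union> C \<union> D \<union> (?R - D)\<inverse> \<subseteq> V \<times> V"
        using BC D assms by (auto simp: cross_pairs_def)
    next
      fix u v assume "(u, v) \<in> B \<union> C \<union> D \<union> (?R - D)\<inverse>"
      moreover have "(v, u) \<notin> B" if "(u, v) \<in> B" using that B by (auto simp: tournament_alt)
      moreover have "(v, u) \<notin> C" if "(u, v) \<in> C" using that C by (auto simp: tournament_alt)
      moreover have "(u, v) \<notin> ?R \<and> (v, u) \<notin> ?R \<and> (v, u) \<notin> C" if "(u, v) \<in> B"
        using that BC assms(4) by (auto simp: cross_pairs_def)
      moreover have "(u, v) \<notin> ?R \<and> (v, u) \<notin> ?R \<and> (v, u) \<notin> B" if "(u, v) \<in> C"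
        using that BC assms(4) by (auto simp: cross_pairs_def)
      moreover have "(v, u) \<notin> ?R \<and> (v, u) \<notin> B \<and> (v, u) \<notin> C" if "(u, v) \<in> ?R"
        using that BC by (auto simp: cross_pairs_def)
      moreover have "(u, v) \<notin> ?R \<and> (v, u) \<notin> B \<and> (v, u) \<notin> C" if "(v, u) \<in> ?R"
        using that BC by (auto simp: cross_pairs_def)
      ultimately show "(v, u) \<notin> B \<union> C \<union> D \<union> (?R - D)\<inverse>"
        using D by blast
    next
      fix u v assume uv: "u \<in> V" "v \<in> V" "u \<noteq> v"
      then have "u \<in> X \<and> v \<in> X \<or> u \<in> Y \<and> v \<in> Y \<or> (u, v) \<in> ?R \<or> (v, u) \<in> ?R"
        by (auto simp: cross_pairs_def)
      moreover have "(u, v) \<in> B \<or> (v, u) \<in> B" if "u \<in> X" "v \<in> X"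
        using B that uv by (auto simp: tournament_alt)
      moreover have "(u, v) \<in> C \<or> (v, u) \<in> C" if "u \<in> Y" "v \<in> Y"
        using C that uv by (auto simp: tournament_alt)
      ultimately show "(u, v) \<in> B \<union> C \<union> D \<union> (?R - D)\<inverse> \<or> (v, u) \<in> B \<union> C \<union> D \<union> (?R - D)\<inverse>"
        by blast
    qed (rule assms(1))
    then show "?g p \<in> {A. tournament V A}" by (simp add: p)
  qed
qed

lemma card_increasing_pairs:
  fixes V :: "nat set"
  assumes "finite V"
  shows "card {(i, j) \<in> V \<times> V. i < j} = card V choose 2"
proof -
  let ?E = "{(i, j) \<in> V \<times> V. i < j}"
  have finE: "finite ?E" using assms by (auto intro: finite_subset[of _ "V \<times> V"])
  have VV: "V \<times> V = ?E \<union> ?E\<inverse> \<union> Id_on V" by (auto simp: Id_on_def)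
  have idV: "card (Id_on V) = card V"
    unfolding Id_on_def using assms by (subst card_UN_disjoint) auto
  have "card V * card V = card (V \<times> V)" by (simp add: card_cartesian_product)
  also have "\<dots> = card (?E \<union> ?E\<inverse> \<union> Id_on V)" by (rule arg_cong[OF VV])
  also have "\<dots> = card ?E + card (?E\<inverse>) + card (Id_on V)"
    using finE assms by (subst card_Un_disjoint, auto simp: Id_on_def)+
  also have "\<dots> = 2 * card ?E + card V"
    using card_inverse[of ?E] idV by linarith
  finally have "card V * card V = 2 * card ?E + card V" .
  then have "2 * card ?E = card V * (card V - 1)" by (simp add: diff_mult_distrib2)
  then show ?thesis by (simp add: choose_two)
qed

lemma card_tournaments:
  fixes V :: "nat set"
  assumes "finite V"
  shows "card {A. tournament V A} = 2 ^ (card V choose 2)"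
proof -
  have e: "{A. tournament {} A} = {{}}" by (auto simp: tournament_def)
  have c: "cross_pairs V {} {} = {(i, j) \<in> V \<times> V. i < j}" by (auto simp: cross_pairs_def)
  have "card (cross_pairs V {} {}) = card V choose 2"
    unfolding c by (rule card_increasing_pairs[OF assms])
  moreover have "finite (cross_pairs V {} {})"
    unfolding c using assms by (auto intro: finite_subset[of _ "V \<times> V"])
  ultimately show ?thesis
    using bij_betw_same_card[OF bij_betw_split_tournaments[OF assms, of "{}" "{}"]]
    by (simp add: e card_cartesian_product card_Pow)
qed

section \<open>The quasi-random values\<close>

text \<open>\<open>|V(T)|! / (|Aut(T)| \<cdot> 2\<^bsup>C(|V(T)|, 2)\<^esup>)\<close>, the limit density of \<open>T\<close> in uniformly random
  tournaments.\<close>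

definition qr_value :: "tclass \<Rightarrow> real" where
  "qr_value T = fact (num_verts T) / (real (num_auts T) * 2 ^ (num_verts T choose 2))"

lemma qr_value_eq:
  assumes "finite X" "card X = num_verts T"
  shows "qr_value T = real (card {A. tournament X A \<and> tclass_of X A = T})
    / real (card {A. tournament X A})"
proof -
  have "real (card {A. tournament X A \<and> tclass_of X A = T}) * real (num_auts T) = fact (num_verts T)"
    using card_labelled[OF assms] by (metis of_nat_fact of_nat_mult)
  moreover have "real (card {A. tournament X A}) = 2 ^ (num_verts T choose 2)"
    using card_tournaments[OF assms(1)] assms(2) by simp
  ultimately show ?thesis
    using num_auts_pos[of T] by (simp add: qr_value_def field_simps)
qed

lemma sum_density2_qr_value:
  assumes m: "num_verts T1 + num_verts T2 \<le> m"
  shows "(\<Sum>N\<in>tclasses m. tdensity2 T1 T2 N * qr_value N) = qr_value T1 * qr_value T2"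
proof -
  define V where "V = {..<m}"
  have V: "finite V" "card V = m" by (simp_all add: V_def)
  let ?D = "disjoint_subsets V (num_verts T1) (num_verts T2)"
  let ?Q = "\<lambda>X. {A. tournament X A}"
  let ?o = "\<lambda>A X Y. of_bool (induced A X = T1) * of_bool (induced A Y = T2) :: real"
  have finQ: "finite (?Q V)" by (rule finite_tournaments[OF V(1)])
  have Q: "real (card (?Q X)) > 0" if "finite X" for X :: "nat set"
    using card_tournaments[OF that] by simp
  have D: "real (card ?D) > 0" using card_disjoint_subsets_pos[OF V(1)] m V(2) by simp
  have qr: "qr_value N = (\<Sum>A\<in>?Q V. of_bool (tclass_of V A = N)) / real (card (?Q V))"
    if "N \<in> tclasses m" for N
  proof -
    have "(\<Sum>A\<in>?Q V. of_bool (tclass_of V A = N) :: real) =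
        (\<Sum>A\<in>?Q V. if tclass_of V A = N then 1 else 0)"
      by (rule sum.cong) auto
    also have "\<dots> = real (card {A \<in> ?Q V. tclass_of V A = N})"
      by (subst sum.inter_filter[OF finQ, symmetric]) simp
    finally show ?thesis
      using qr_value_eq[OF V(1), of N] V(2) that by (simp add: tclasses_def)
  qed
  have main: "(\<Sum>A\<in>?Q V. ?o A X Y) = qr_value T1 * qr_value T2 * real (card (?Q V))"
    if XY: "(X, Y) \<in> ?D" for X Y
  proof -
    have XY: "X \<subseteq> V" "Y \<subseteq> V" "X \<inter> Y = {}" "card X = num_verts T1" "card Y = num_verts T2"
      using that by (auto simp: disjoint_subsets_def)
    have fin: "finite X" "finite Y" using XY V(1) by (meson finite_subset)+
    note bij = bij_betw_split_tournaments[OF V(1) XY(1-3)]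
    let ?R = "cross_pairs V X Y"
    have cnt: "(\<Sum>B\<in>?Q Z. of_bool (tclass_of Z B = T)) = qr_value T * real (card (?Q Z))"
      if "finite Z" "card Z = num_verts T" for Z T
    proof -
      have "(\<Sum>B\<in>?Q Z. of_bool (tclass_of Z B = T) :: real) =
          (\<Sum>B\<in>?Q Z. if tclass_of Z B = T then 1 else 0)"
        by (rule sum.cong) auto
      also have "\<dots> = real (card {B \<in> ?Q Z. tclass_of Z B = T})"
        by (subst sum.inter_filter[OF finite_tournaments[OF that(1)], symmetric]) simp
      finally show ?thesis using qr_value_eq[OF that] Q[OF that(1)] by simp
    qed
    have "(\<Sum>A\<in>?Q V. ?o A X Y) =
        (\<Sum>(B, C, D)\<in>?Q X \<times> ?Q Y \<times> Pow ?R. of_bool (tclass_of X B = T1) * of_bool (tclass_of Y C = T2))"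
      unfolding sum.reindex_bij_betw[OF bij, symmetric] by (simp add: induced_def)
    also have "\<dots> = (\<Sum>B\<in>?Q X. of_bool (tclass_of X B = T1)) *
        (\<Sum>C\<in>?Q Y. of_bool (tclass_of Y C = T2)) * real (card (Pow ?R))"
      by (simp add: sum.cartesian_product[symmetric] sum_distrib_left sum_distrib_right mult_ac)
        (rule sum.swap)
    also have "\<dots> = qr_value T1 * qr_value T2 *
        real (card (?Q X) * (card (?Q Y) * card (Pow ?R)))"
      using cnt[OF fin(1) XY(4)] cnt[OF fin(2) XY(5)] by simp
    also have "card (?Q X) * (card (?Q Y) * card (Pow ?R)) = card (?Q V)"
      using bij_betw_same_card[OF bij] by (simp add: card_cartesian_product)
    finally show ?thesis .
  qed
  have "(\<Sum>N\<in>tclasses m. tdensity2 T1 T2 N * qr_value N) =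
      (\<Sum>N\<in>tclasses m. \<Sum>A\<in>?Q V. tdensity2 T1 T2 N * of_bool (tclass_of V A = N)) / real (card (?Q V))"
    by (simp add: qr sum_distrib_left sum_divide_distrib)
  also have "(\<Sum>N\<in>tclasses m. \<Sum>A\<in>?Q V. tdensity2 T1 T2 N * of_bool (tclass_of V A = N)) =
      (\<Sum>A\<in>?Q V. \<Sum>N\<in>tclasses m. tdensity2 T1 T2 N * of_bool (tclass_of V A = N))"
    by (rule sum.swap)
  also have "\<dots> = (\<Sum>A\<in>?Q V. tdensity2 T1 T2 (tclass_of V A))"
  proof (rule sum.cong[OF refl])
    fix A assume "A \<in> ?Q V"
    then have "tclass_of V A \<in> tclasses m"
      using num_verts_tclass_of V(2) by (simp add: tclasses_def)
    have "(\<Sum>N\<in>tclasses m. tdensity2 T1 T2 N * of_bool (tclass_of V A = N)) =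
        (\<Sum>N\<in>tclasses m. if tclass_of V A = N then tdensity2 T1 T2 N else 0)"
      by (rule sum.cong) auto
    then show "(\<Sum>N\<in>tclasses m. tdensity2 T1 T2 N * of_bool (tclass_of V A = N)) =
        tdensity2 T1 T2 (tclass_of V A)"
      using \<open>tclass_of V A \<in> tclasses m\<close> by (simp add: finite_tclasses)
  qed
  also have "\<dots> = (\<Sum>A\<in>?Q V. \<Sum>(X, Y)\<in>?D. ?o A X Y) / real (card ?D)"
    unfolding sum_divide_distrib[of _ "?Q V"]
    by (intro sum.cong refl tdensity2_tclass_of) simp
  also have "(\<Sum>A\<in>?Q V. \<Sum>(X, Y)\<in>?D. ?o A X Y) = (\<Sum>(X, Y)\<in>?D. \<Sum>A\<in>?Q V. ?o A X Y)"
    unfolding case_prod_unfold by (rule sum.swap)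
  also have "\<dots> = (\<Sum>(X, Y)\<in>?D. qr_value T1 * qr_value T2 * real (card (?Q V)))"
    using main by (intro sum.cong) auto
  also have "\<dots> / real (card ?D) / real (card (?Q V)) = qr_value T1 * qr_value T2"
    using D Q[OF V(1)] by simp
  finally show ?thesis .
qed

lemma qr_value_empty: "qr_value empty_tclass = 1"
proof -
  have "{A. tournament {} A \<and> tclass_of {} A = empty_tclass} = {{}}"
    "{A. tournament ({} :: nat set) A} = {{}}"
    by (auto simp: tournament_def empty_tclass_def)
  then show ?thesis
    using qr_value_eq[of "{}" empty_tclass] unfolding num_verts_empty by simp
qed

lemma qr_value_nonneg: "qr_value T \<ge> 0"
  by (simp add: qr_value_def)

lemma sum_density_qr_value:
  assumes "num_verts T \<le> m"
  shows "(\<Sum>N\<in>tclasses m. tdensity T N * qr_value N) = qr_value T"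
  using sum_density2_qr_value[of T empty_tclass m] assms
  by (simp add: num_verts_empty qr_value_empty tdensity2_empty)

section \<open>The vector space with basis \<^typ>\<open>tclass\<close> and its product\<close>

lemma lookup_scaleR_poly_mapping:
  "Poly_Mapping.lookup (r *\<^sub>R x) i = r *\<^sub>R Poly_Mapping.lookup x i"
proof -
  have "finite {i. r *\<^sub>R Poly_Mapping.lookup x i \<noteq> 0}"
    by (rule finite_subset[OF _ finite_keys[of x]]) (auto simp: in_keys_iff)
  then show ?thesis by (simp add: scaleR_poly_mapping_def)
qed

definition basis_vec :: "'a \<Rightarrow> 'a \<Rightarrow>\<^sub>0 real" where
  "basis_vec T = Poly_Mapping.single T 1"

text \<open>The linear map with prescribed values on the basis.\<close>

definition lin_extend :: "('a \<Rightarrow> 'b::real_vector) \<Rightarrow> ('a \<Rightarrow>\<^sub>0 real) \<Rightarrow> 'b" where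
  "lin_extend f x = (\<Sum>T\<in>Poly_Mapping.keys x. Poly_Mapping.lookup x T *\<^sub>R f T)"

lemma lin_extend_superset:
  assumes "finite K" "Poly_Mapping.keys x \<subseteq> K"
  shows "lin_extend f x = (\<Sum>T\<in>K. Poly_Mapping.lookup x T *\<^sub>R f T)"
  unfolding lin_extend_def
  by (rule sum.mono_neutral_left) (use assms in \<open>auto simp: in_keys_iff\<close>)

lemma linear_lin_extend: "linear (lin_extend f)"
proof
  fix x y :: "'a \<Rightarrow>\<^sub>0 real" and r :: real
  let ?K = "Poly_Mapping.keys x \<union> Poly_Mapping.keys y"
  have "lin_extend f (x + y) = (\<Sum>T\<in>?K. Poly_Mapping.lookup (x + y) T *\<^sub>R f T)"
    by (rule lin_extend_superset) (use keys_add[of x y] in auto)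
  moreover have "lin_extend f x = (\<Sum>T\<in>?K. Poly_Mapping.lookup x T *\<^sub>R f T)"
    by (rule lin_extend_superset) auto
  moreover have "lin_extend f y = (\<Sum>T\<in>?K. Poly_Mapping.lookup y T *\<^sub>R f T)"
    by (rule lin_extend_superset) auto
  ultimately show "lin_extend f (x + y) = lin_extend f x + lin_extend f y"
    by (simp add: lookup_add scaleR_add_left sum.distrib)
  have "lin_extend f (r *\<^sub>R x) = (\<Sum>T\<in>Poly_Mapping.keys x. Poly_Mapping.lookup (r *\<^sub>R x) T *\<^sub>R f T)"
    by (rule lin_extend_superset) (auto simp: in_keys_iff lookup_scaleR_poly_mapping)
  then show "lin_extend f (r *\<^sub>R x) = r *\<^sub>R lin_extend f x"
    by (simp add: lin_extend_def lookup_scaleR_poly_mapping scaleR_sum_right)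
qed

lemma lin_extend_basis [simp]: "lin_extend f (basis_vec T) = f T"
  by (simp add: lin_extend_def basis_vec_def)

lemma lin_extend_id: "lin_extend basis_vec x = x"
proof (rule poly_mapping_eqI)
  fix k
  have "Poly_Mapping.lookup (lin_extend basis_vec x) k =
      (\<Sum>T\<in>Poly_Mapping.keys x. if k = T then Poly_Mapping.lookup x T else 0)"
    unfolding lin_extend_def lookup_sum
    by (intro sum.cong) (auto simp: lookup_scaleR_poly_mapping basis_vec_def lookup_single when_def)
  also have "\<dots> = Poly_Mapping.lookup x k"
    by (simp add: in_keys_iff)
  finally show "Poly_Mapping.lookup (lin_extend basis_vec x) k = Poly_Mapping.lookup x k" .
qed

lemma linear_eqI_basis_vec:
  fixes f g :: "('a \<Rightarrow>\<^sub>0 real) \<Rightarrow> 'b::real_vector"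
  assumes "linear f" "linear g" "\<And>T. f (basis_vec T) = g (basis_vec T)"
  shows "f x = g x"
proof -
  have "h x = (\<Sum>T\<in>Poly_Mapping.keys x. Poly_Mapping.lookup x T *\<^sub>R h (basis_vec T))"
    if "linear h" for h :: "('a \<Rightarrow>\<^sub>0 real) \<Rightarrow> 'b"
  proof -
    interpret linear h by fact
    have "h x = h (lin_extend basis_vec x)" by (simp add: lin_extend_id)
    also have "\<dots> = (\<Sum>T\<in>Poly_Mapping.keys x. Poly_Mapping.lookup x T *\<^sub>R h (basis_vec T))"
      by (simp add: lin_extend_def sum scale)
    finally show ?thesis .
  qed
  from this[OF assms(1)] this[OF assms(2)] show ?thesis using assms(3) by simp
qed

text \<open>The product of tournaments with the least admissible number of vertices; see
  \<open>flag_times_flag\<close> below for the independence of that choice in the quotient.\<close>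

definition basis_product :: "tclass \<Rightarrow> tclass \<Rightarrow> tclass \<Rightarrow>\<^sub>0 real" where
  "basis_product S T =
     (\<Sum>N\<in>tclasses (num_verts S + num_verts T). tdensity2 S T N *\<^sub>R basis_vec N)"

definition free_product :: "(tclass \<Rightarrow>\<^sub>0 real) \<Rightarrow> (tclass \<Rightarrow>\<^sub>0 real) \<Rightarrow> tclass \<Rightarrow>\<^sub>0 real" where
  "free_product x y = lin_extend (\<lambda>S. lin_extend (\<lambda>T. basis_product S T) y) x"

lemma free_product_basis: "free_product (basis_vec S) (basis_vec T) = basis_product S T"
  by (simp add: free_product_def)

lemma linear_free_product_left: "linear (\<lambda>x. free_product x y)"
  unfolding free_product_def by (rule linear_lin_extend)

lemma basis_product_commute: "basis_product S T = basis_product T S"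
  by (simp add: basis_product_def tdensity2_commute add.commute)

lemma linear_free_product_right: "linear (free_product x)"
proof
  fix y z and r :: real
  interpret l: linear "lin_extend (\<lambda>T. basis_product S T)" for S
    by (rule linear_lin_extend)
  show "free_product x (y + z) = free_product x y + free_product x z"
    by (simp add: free_product_def lin_extend_def[of _ x] l.add scaleR_add_right sum.distrib)
  show "free_product x (r *\<^sub>R y) = r *\<^sub>R free_product x y"
    by (simp add: free_product_def lin_extend_def[of _ x] l.scale scaleR_sum_right mult.commute)
qed

lemma free_product_commute: "free_product x y = free_product y x"
proof -
  have "free_product (basis_vec S) y = free_product y (basis_vec S)" for S y
    by (rule linear_eqI_basis_vec[OF linear_free_product_right linear_free_product_left])
      (simp add: free_product_basis basis_product_commute)
  then show ?thesis
    using linear_eqI_basis_vec[of "\<lambda>x. free_product x y" "free_product y" x]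
      linear_free_product_left linear_free_product_right by blast
qed

lemma free_product_empty: "free_product x (basis_vec empty_tclass) = x"
proof -
  have "basis_product T empty_tclass = basis_vec T" for T
  proof -
    have "basis_product T empty_tclass = (\<Sum>N\<in>tclasses (num_verts T). tdensity T N *\<^sub>R basis_vec N)"
      by (simp add: basis_product_def num_verts_empty tdensity2_empty)
    also have "\<dots> = (\<Sum>N\<in>tclasses (num_verts T). if N = T then basis_vec N else 0)"
      by (rule sum.cong) (auto simp: tdensity_same_size tclasses_def)
    also have "\<dots> = basis_vec T"
      using finite_tclasses by (simp add: tclasses_def)
    finally show ?thesis .
  qed
  then have "free_product (basis_vec T) (basis_vec empty_tclass) = basis_vec T" for T
    by (simp add: free_product_basis)
  then show ?thesis
    using linear_eqI_basis_vec[of "\<lambda>x. free_product x (basis_vec empty_tclass)" "\<lambda>x. x" x]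
      linear_free_product_left linear_ident by blast
qed

lemma free_product_basis_product_left:
  "free_product (basis_product S T) (basis_vec U) =
    (\<Sum>N\<in>tclasses (num_verts S + num_verts T + num_verts U).
      (\<Sum>M\<in>tclasses (num_verts S + num_verts T). tdensity2 S T M * tdensity2 M U N) *\<^sub>R basis_vec N)"
proof -
  interpret l: linear "\<lambda>x. free_product x (basis_vec U)"
    by (rule linear_free_product_left)
  have "free_product (basis_product S T) (basis_vec U) =
      (\<Sum>M\<in>tclasses (num_verts S + num_verts T). tdensity2 S T M *\<^sub>R basis_product M U)"
    by (simp add: basis_product_def[of S T] l.sum l.scale free_product_basis)
  also have "\<dots> = (\<Sum>M\<in>tclasses (num_verts S + num_verts T).
      \<Sum>N\<in>tclasses (num_verts S + num_verts T + num_verts U).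
        (tdensity2 S T M * tdensity2 M U N) *\<^sub>R basis_vec N)"
    by (rule sum.cong) (auto simp: basis_product_def scaleR_sum_right tclasses_def)
  also have "\<dots> = (\<Sum>N\<in>tclasses (num_verts S + num_verts T + num_verts U).
      \<Sum>M\<in>tclasses (num_verts S + num_verts T).
        (tdensity2 S T M * tdensity2 M U N) *\<^sub>R basis_vec N)"
    by (rule sum.swap)
  finally show ?thesis by (simp add: scaleR_sum_left)
qed

lemma free_product_assoc: "free_product (free_product x y) z = free_product x (free_product y z)"
proof -
  have b: "free_product (basis_product S T) (basis_vec U) = free_product (basis_vec S) (basis_product T U)"
    for S T U
  proof -
    have "free_product (basis_vec S) (basis_product T U) = free_product (basis_product T U) (basis_vec S)"
      by (rule free_product_commute)
    also have "\<dots> = (\<Sum>N\<in>tclasses (num_verts S + num_verts T + num_verts U).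
      (\<Sum>M\<in>tclasses (num_verts T + num_verts U). tdensity2 T U M * tdensity2 S M N) *\<^sub>R basis_vec N)"
      unfolding free_product_basis_product_left tdensity2_commute[of _ S] by (simp add: add_ac)
    also have "\<dots> = (\<Sum>N\<in>tclasses (num_verts S + num_verts T + num_verts U).
      (\<Sum>M\<in>tclasses (num_verts S + num_verts T). tdensity2 S T M * tdensity2 M U N) *\<^sub>R basis_vec N)"
      by (intro sum.cong refl arg_cong2[where f = scaleR] sum_density2_assoc[symmetric])
        (simp add: tclasses_def)
    finally show ?thesis unfolding free_product_basis_product_left by simp
  qed
  note lin = linear_free_product_left linear_free_product_right
  have comp1: "linear (\<lambda>x. free_product (free_product x y) z)" for y z
    using linear_compose[OF lin(1)[of y] lin(1)[of z]] by (simp add: o_def)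
  have comp2: "linear (\<lambda>y. free_product (free_product x y) z)" for x z
    using linear_compose[OF lin(2)[of x] lin(1)[of z]] by (simp add: o_def)
  have comp3: "linear (\<lambda>y. free_product x (free_product y z))" for x z
    using linear_compose[OF lin(1)[of z] lin(2)[of x]] by (simp add: o_def)
  have comp4: "linear (\<lambda>z. free_product x (free_product y z))" for x y
    using linear_compose[OF lin(2)[of y] lin(2)[of x]] by (simp add: o_def)
  have 1: "free_product (free_product (basis_vec S) (basis_vec T)) z =
      free_product (basis_vec S) (free_product (basis_vec T) z)" for S T z
    by (rule linear_eqI_basis_vec[where x = z, OF lin(2) comp4]) (simp add: free_product_basis b)
  have 2: "free_product (free_product (basis_vec S) y) z =
      free_product (basis_vec S) (free_product y z)" for S y z
    by (rule linear_eqI_basis_vec[where x = y, OF comp2 comp3]) (rule 1)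
  show ?thesis
    by (rule linear_eqI_basis_vec[where x = x, OF comp1 lin(1)]) (rule 2)
qed

section \<open>The flag algebra of unlabelled tournaments\<close>

definition flag_relations :: "(tclass \<Rightarrow>\<^sub>0 real) set" where
  "flag_relations = span {basis_vec T - (\<Sum>N\<in>tclasses m. tdensity T N *\<^sub>R basis_vec N) | T m.
     num_verts T \<le> m}"

lemma subspace_flag_relations: "subspace flag_relations"
  unfolding flag_relations_def by (rule subspace_span)

lemma flag_relations_base:
  "num_verts T \<le> m \<Longrightarrow> basis_vec T - (\<Sum>N\<in>tclasses m. tdensity T N *\<^sub>R basis_vec N) \<in> flag_relations"
  unfolding flag_relations_def by (rule span_base) blast

lemma linear_in_subspace_induct:
  assumes "linear f" "subspace U" "\<And>T. f (basis_vec T) \<in> U"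
  shows "f x \<in> U"
proof -
  interpret linear f by fact
  have "f x = f (lin_extend basis_vec x)" by (simp add: lin_extend_id)
  also have "\<dots> = (\<Sum>T\<in>Poly_Mapping.keys x. Poly_Mapping.lookup x T *\<^sub>R f (basis_vec T))"
    by (simp add: lin_extend_def sum scale)
  also have "\<dots> \<in> U"
    using assms(2,3) by (intro subspace_sum subspace_scale)
  finally show ?thesis .
qed

lemma basis_product_cong:
  assumes m: "num_verts S + num_verts T \<le> m"
  shows "basis_product S T - (\<Sum>N\<in>tclasses m. tdensity2 S T N *\<^sub>R basis_vec N) \<in> flag_relations"
proof -
  let ?n = "num_verts S + num_verts T"
  let ?g = "\<lambda>M. basis_vec M - (\<Sum>N\<in>tclasses m. tdensity M N *\<^sub>R basis_vec N)"
  have "(\<Sum>N\<in>tclasses m. tdensity2 S T N *\<^sub>R basis_vec N) =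
      (\<Sum>N\<in>tclasses m. \<Sum>M\<in>tclasses ?n. (tdensity2 S T M * tdensity M N) *\<^sub>R basis_vec N)"
  proof (rule sum.cong[OF refl])
    fix N assume "N \<in> tclasses m"
    then have "tdensity2 S T N = (\<Sum>M\<in>tclasses ?n. tdensity2 S T M * tdensity M N)"
      using sum_density2_density[of S T ?n N] m by (simp add: tclasses_def)
    then show "tdensity2 S T N *\<^sub>R basis_vec N =
        (\<Sum>M\<in>tclasses ?n. (tdensity2 S T M * tdensity M N) *\<^sub>R basis_vec N)"
      by (simp add: scaleR_sum_left)
  qed
  also have "\<dots> = (\<Sum>M\<in>tclasses ?n. \<Sum>N\<in>tclasses m. (tdensity2 S T M * tdensity M N) *\<^sub>R basis_vec N)"
    by (rule sum.swap)
  finally have "basis_product S T - (\<Sum>N\<in>tclasses m. tdensity2 S T N *\<^sub>R basis_vec N) =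
      (\<Sum>M\<in>tclasses ?n. tdensity2 S T M *\<^sub>R ?g M)"
    by (simp add: basis_product_def scaleR_diff_right scaleR_sum_right sum_subtractf)
  also have "\<dots> \<in> flag_relations"
    using m by (intro subspace_sum subspace_scale subspace_flag_relations flag_relations_base)
      (simp add: tclasses_def)
  finally show ?thesis .
qed

lemma free_product_flag_relations_left:
  assumes "x \<in> flag_relations"
  shows "free_product x y \<in> flag_relations"
proof (rule linear_in_subspace_induct[OF linear_free_product_right subspace_flag_relations])
  fix U
  interpret l: linear "\<lambda>x. free_product x (basis_vec U)"
    by (rule linear_free_product_left)
  let ?G = "{basis_vec T - (\<Sum>N\<in>tclasses m. tdensity T N *\<^sub>R basis_vec N) | T m. num_verts T \<le> m}"
  have "(\<lambda>x. free_product x (basis_vec U)) ` ?G \<subseteq> flag_relations"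
  proof clarify
    fix T m assume m: "num_verts T \<le> m"
    let ?n = "m + num_verts U"
    have "free_product (\<Sum>M\<in>tclasses m. tdensity T M *\<^sub>R basis_vec M) (basis_vec U) =
        (\<Sum>M\<in>tclasses m. tdensity T M *\<^sub>R basis_product M U)"
      by (simp add: l.sum l.scale free_product_basis)
    also have "\<dots> = (\<Sum>M\<in>tclasses m. \<Sum>N\<in>tclasses ?n. (tdensity T M * tdensity2 M U N) *\<^sub>R basis_vec N)"
      by (rule sum.cong) (auto simp: basis_product_def scaleR_sum_right tclasses_def)
    also have "\<dots> = (\<Sum>N\<in>tclasses ?n. \<Sum>M\<in>tclasses m. (tdensity T M * tdensity2 M U N) *\<^sub>R basis_vec N)"
      by (rule sum.swap)
    also have "\<dots> = (\<Sum>N\<in>tclasses ?n. tdensity2 T U N *\<^sub>R basis_vec N)"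
    proof (rule sum.cong[OF refl])
      fix N assume "N \<in> tclasses ?n"
      then show "(\<Sum>M\<in>tclasses m. (tdensity T M * tdensity2 M U N) *\<^sub>R basis_vec N) =
          tdensity2 T U N *\<^sub>R basis_vec N"
        using sum_density_density2[OF m, of U N]
        by (simp add: scaleR_sum_left[symmetric] tclasses_def)
    qed
    finally have "free_product (basis_vec T - (\<Sum>N\<in>tclasses m. tdensity T N *\<^sub>R basis_vec N)) (basis_vec U) =
        basis_product T U - (\<Sum>N\<in>tclasses ?n. tdensity2 T U N *\<^sub>R basis_vec N)"
      by (simp add: l.diff free_product_basis)
    also have "\<dots> \<in> flag_relations"
      using m by (intro basis_product_cong) simp
    finally show "free_product (basis_vec T - (\<Sum>N\<in>tclasses m. tdensity T N *\<^sub>R basis_vec N)) (basis_vec U)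
        \<in> flag_relations" .
  qed
  then have "span ((\<lambda>x. free_product x (basis_vec U)) ` ?G) \<subseteq> flag_relations"
    using subspace_flag_relations by (rule span_minimal)
  moreover have "free_product x (basis_vec U) \<in> (\<lambda>x. free_product x (basis_vec U)) ` span ?G"
    using assms unfolding flag_relations_def by (rule imageI)
  ultimately show "free_product x (basis_vec U) \<in> flag_relations"
    unfolding linear_span_image[OF l.linear_axioms] by blast
qed

lemma lin_extend_qr_value_flag_relations:
  assumes "x \<in> flag_relations"
  shows "lin_extend qr_value x = 0"
proof -
  interpret l: linear "lin_extend qr_value" by (rule linear_lin_extend)
  have "x \<in> span {basis_vec T - (\<Sum>N\<in>tclasses m. tdensity T N *\<^sub>R basis_vec N) | T m. num_verts T \<le> m}"
    using assms by (simp add: flag_relations_def)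
  then show ?thesis
  proof (rule linear_eq_0_on_span[OF l.linear_axioms, rotated])
    fix y assume "y \<in> {basis_vec T - (\<Sum>N\<in>tclasses m. tdensity T N *\<^sub>R basis_vec N) | T m. num_verts T \<le> m}"
    then obtain T m where y: "y = basis_vec T - (\<Sum>N\<in>tclasses m. tdensity T N *\<^sub>R basis_vec N)"
      and m: "num_verts T \<le> m" by blast
    show "lin_extend qr_value y = 0"
      using sum_density_qr_value[OF m] by (simp add: y l.diff l.sum l.scale)
  qed
qed

quotient_type flag_algebra = "tclass \<Rightarrow>\<^sub>0 real" / "\<lambda>x y. x - y \<in> flag_relations"
proof (rule equivpI)
  show "reflp (\<lambda>x y. x - y \<in> flag_relations)"
    by (simp add: reflp_def subspace_0[OF subspace_flag_relations])
  show "symp (\<lambda>x y. x - y \<in> flag_relations)"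
    using subspace_neg[OF subspace_flag_relations] by (fastforce simp: symp_def)
  show "transp (\<lambda>x y. x - y \<in> flag_relations)"
    using subspace_add[OF subspace_flag_relations] by (fastforce simp: transp_def)
qed

lifting_forget tclass.lifting

text \<open>The image of a tournament under the quotient map.\<close>

lift_definition flag :: "tclass \<Rightarrow> flag_algebra" is basis_vec .

instantiation flag_algebra :: "{real_algebra_1, comm_ring_1}"
begin

lift_definition zero_flag_algebra :: flag_algebra is 0 .

lift_definition one_flag_algebra :: flag_algebra is "basis_vec empty_tclass" .

lift_definition plus_flag_algebra :: "flag_algebra \<Rightarrow> flag_algebra \<Rightarrow> flag_algebra" is "(+)"
  using subspace_add[OF subspace_flag_relations] by (simp add: add_diff_add)

lift_definition uminus_flag_algebra :: "flag_algebra \<Rightarrow> flag_algebra" is uminus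
  using subspace_neg[OF subspace_flag_relations] by fastforce

lift_definition minus_flag_algebra :: "flag_algebra \<Rightarrow> flag_algebra \<Rightarrow> flag_algebra" is "(-)"
proof -
  fix a b c d :: "tclass \<Rightarrow>\<^sub>0 real"
  assume "a - b \<in> flag_relations" "c - d \<in> flag_relations"
  then have "(a - b) - (c - d) \<in> flag_relations"
    by (rule subspace_diff[OF subspace_flag_relations])
  then show "a - c - (b - d) \<in> flag_relations" by (simp add: algebra_simps)
qed

lift_definition scaleR_flag_algebra :: "real \<Rightarrow> flag_algebra \<Rightarrow> flag_algebra" is scaleR
  using subspace_scale[OF subspace_flag_relations] by (simp add: scaleR_diff_right[symmetric])

lift_definition times_flag_algebra :: "flag_algebra \<Rightarrow> flag_algebra \<Rightarrow> flag_algebra"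
  is free_product
proof -
  fix a b c d :: "tclass \<Rightarrow>\<^sub>0 real"
  assume *: "a - b \<in> flag_relations" "c - d \<in> flag_relations"
  have "free_product a c - free_product b d = free_product (a - b) c + free_product (c - d) b"
    using linear_diff[OF linear_free_product_left[of c], of a b]
      linear_diff[OF linear_free_product_right[of b], of c d]
    by (simp add: free_product_commute[of "c - d"])
  then show "free_product a c - free_product b d \<in> flag_relations"
    using * by (simp add: subspace_add[OF subspace_flag_relations] free_product_flag_relations_left)
qed

instance
proof
  fix a b c :: flag_algebra and r s :: real
  have eq: "x = y \<Longrightarrow> x - y \<in> flag_relations" for x y
    by (simp add: subspace_0[OF subspace_flag_relations])
  show "a + b + c = a + (b + c)" by transfer (rule eq, simp)
  show "a + b = b + a" by transfer (rule eq, simp)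
  show "0 + a = a" by transfer (rule eq, simp)
  show "- a + a = 0" by transfer (rule eq, simp)
  show "a - b = a + - b" by transfer (rule eq, simp)
  show "r *\<^sub>R (a + b) = r *\<^sub>R a + r *\<^sub>R b" by transfer (rule eq, simp add: scaleR_add_right)
  show "(r + s) *\<^sub>R a = r *\<^sub>R a + s *\<^sub>R a" by transfer (rule eq, simp add: scaleR_add_left)
  show "r *\<^sub>R s *\<^sub>R a = (r * s) *\<^sub>R a" by transfer (rule eq, simp)
  show "1 *\<^sub>R a = a" by transfer (rule eq, simp)
  show "a * b * c = a * (b * c)" by transfer (rule eq, rule free_product_assoc)
  show "a * b = b * a" by transfer (rule eq, rule free_product_commute)
  show "1 * a = a"
    by transfer (rule eq, subst free_product_commute, rule free_product_empty)
  show "a * 1 = a"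
    by transfer (rule eq, rule free_product_empty)
  show "a * (b + c) = a * b + a * c"
    by transfer (rule eq, rule linear_add[OF linear_free_product_right])
  show "(a + b) * c = a * c + b * c"
    by transfer (rule eq, rule linear_add[OF linear_free_product_left])
  show "r *\<^sub>R a * b = r *\<^sub>R (a * b)"
    by transfer (rule eq, rule linear_cmul[OF linear_free_product_left])
  show "a * r *\<^sub>R b = r *\<^sub>R (a * b)"
    by transfer (rule eq, rule linear_cmul[OF linear_free_product_right])
  show "(0 :: flag_algebra) \<noteq> 1"
  proof
    assume "(0 :: flag_algebra) = 1"
    then have "0 - basis_vec empty_tclass \<in> flag_relations" by transfer
    from lin_extend_qr_value_flag_relations[OF this] show False
      using linear_diff[OF linear_lin_extend[of qr_value], of 0 "basis_vec empty_tclass"]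
        linear_0[OF linear_lin_extend[of qr_value]]
      by (simp add: qr_value_empty)
  qed
qed

end

lemma flag_empty: "flag empty_tclass = 1"
  by transfer (simp add: subspace_0[OF subspace_flag_relations])

lemma linear_lift_flag_algebra: "linear abs_flag_algebra"
proof
  fix x y and r :: real
  show "abs_flag_algebra (x + y) = abs_flag_algebra x + abs_flag_algebra y"
    by (simp add: plus_flag_algebra.abs_eq)
  show "abs_flag_algebra (r *\<^sub>R x) = r *\<^sub>R abs_flag_algebra x"
    by (simp add: scaleR_flag_algebra.abs_eq)
qed

lemma flag_expand:
  assumes "num_verts T \<le> m"
  shows "flag T = (\<Sum>N\<in>tclasses m. tdensity T N *\<^sub>R flag N)"
proof -
  interpret l: linear abs_flag_algebra by (rule linear_lift_flag_algebra)
  have "abs_flag_algebra (basis_vec T) =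
      abs_flag_algebra (\<Sum>N\<in>tclasses m. tdensity T N *\<^sub>R basis_vec N)"
    using flag_relations_base[OF assms] by (simp add: flag_algebra.abs_eq_iff)
  then show ?thesis by (simp add: l.sum l.scale flag.abs_eq)
qed

text \<open>The product can be computed with any sufficiently large number of vertices.\<close>

lemma flag_times_flag:
  assumes "num_verts S + num_verts T \<le> m"
  shows "flag S * flag T = (\<Sum>N\<in>tclasses m. tdensity2 S T N *\<^sub>R flag N)"
proof -
  interpret l: linear abs_flag_algebra by (rule linear_lift_flag_algebra)
  have "flag S * flag T = abs_flag_algebra (basis_product S T)"
    by (simp add: flag.abs_eq times_flag_algebra.abs_eq free_product_basis)
  also have "\<dots> = abs_flag_algebra (\<Sum>N\<in>tclasses m. tdensity2 S T N *\<^sub>R basis_vec N)"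
    using basis_product_cong[OF assms] by (simp add: flag_algebra.abs_eq_iff)
  finally show ?thesis by (simp add: l.sum l.scale flag.abs_eq)
qed

section \<open>Positive homomorphisms\<close>

definition Hom_plus :: "(flag_algebra \<Rightarrow> real) set" where
  "Hom_plus = {\<phi>. linear \<phi> \<and> \<phi> 1 = 1 \<and> (\<forall>x y. \<phi> (x * y) = \<phi> x * \<phi> y) \<and> (\<forall>T. \<phi> (flag T) \<ge> 0)}"

lift_definition phi_qr :: "flag_algebra \<Rightarrow> real" is "lin_extend qr_value"
proof -
  fix x y assume "x - y \<in> flag_relations"
  from lin_extend_qr_value_flag_relations[OF this] show "lin_extend qr_value x = lin_extend qr_value y"
    using linear_diff[OF linear_lin_extend[of qr_value], of x y] by simp
qed

lemma phi_qr_flag: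
  "phi_qr (flag T) = fact (num_verts T) / (real (num_auts T) * 2 ^ (num_verts T choose 2))"
  by transfer (simp add: qr_value_def)

lemma phi_qr_in_Hom_plus: "phi_qr \<in> Hom_plus"
proof -
  interpret l: linear "lin_extend qr_value" by (rule linear_lin_extend)
  have "linear phi_qr"
  proof
    fix x y and r :: real
    show "phi_qr (x + y) = phi_qr x + phi_qr y" by transfer (rule l.add)
    show "phi_qr (r *\<^sub>R x) = r *\<^sub>R phi_qr x" by transfer (rule l.scale)
  qed
  moreover have "phi_qr 1 = 1" by transfer (simp add: qr_value_empty)
  moreover have "phi_qr (x * y) = phi_qr x * phi_qr y" for x y
  proof transfer
    fix x y
    have b: "lin_extend qr_value (basis_product S T) = qr_value S * qr_value T" for S T
      using sum_density2_qr_value[of S T, OF order_refl]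
      by (simp add: basis_product_def l.sum l.scale)
    have 1: "lin_extend qr_value (free_product (basis_vec S) y) = qr_value S * lin_extend qr_value y"
      for S y
    proof (rule linear_eqI_basis_vec)
      show "linear (\<lambda>y. lin_extend qr_value (free_product (basis_vec S) y))"
        using linear_compose[OF linear_free_product_right linear_lin_extend] by (simp add: o_def)
      show "linear (\<lambda>y. qr_value S * lin_extend qr_value y)"
        by (rule linear_compose_scale_right[OF linear_lin_extend, of "qr_value S" qr_value, simplified])
    qed (simp add: free_product_basis b)
    show "lin_extend qr_value (free_product x y) = lin_extend qr_value x * lin_extend qr_value y"
    proof (rule linear_eqI_basis_vec[where x = x])
      show "linear (\<lambda>x. lin_extend qr_value (free_product x y))"
        using linear_compose[OF linear_free_product_left linear_lin_extend] by (simp add: o_def)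
      show "linear (\<lambda>x. lin_extend qr_value x * lin_extend qr_value y)"
        by unfold_locales (simp_all add: l.add l.scale distrib_right)
    qed (simp add: 1)
  qed
  moreover have "phi_qr (flag T) \<ge> 0" for T
    by (simp add: phi_qr_flag)
  ultimately show ?thesis by (simp add: Hom_plus_def)
qed

end

theory Submission
  imports Defs
begin

text \<open>
  A positive homomorphism turns, for every \<open>m\<close>, the values \<open>\<phi>(N)\<close> of the tournaments \<open>N\<close> on \<open>m\<close>
  vertices into a probability distribution, and if \<open>T\<close> has at most \<open>m\<close> vertices, then \<open>\<phi>(T)\<close> is the
  mean of \<open>p(T, N)\<close> with respect to it.
  It therefore suffices to prove inequalities for the densities in single finite tournaments, with
  errors that vanish as \<open>m\<close> grows. These inequalities have to be affine in the densities, so that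
  they carry over to the means.

  To avoid errors inside the combinatorial argument, vertices are sampled with repetition, and a
  vertex is taken to beat itself with weight \<open>1/2\<close>. The resulting kernel \<open>a\<close> satisfies
  \<open>a x y + a y x = 1\<close> without exception. Repetitions are rare, so that densities of this kernel are
  uniformly close to subtournament densities (\<open>tdensity_near_hom_density\<close>).

  \<^bold>\<open>Lower bound.\<close> Let \<open>t\<^sub>k\<close> be the probability that \<open>k\<close> random vertices are transitive in the order
  in which they are drawn, and let \<open>u\<^sub>k = 2\<^bsup>C(k,2)\<^esup> t\<^sub>k\<close>. Given a transitive \<open>k\<close>-tuple, let \<open>D\<close> be the
  proportion of vertices beaten by all its members. Adding one more vertex contributes a factor \<open>D\<close>;
  adding two contributes \<open>D\<^sup>2/2\<close>, because of the two vertices drawn exactly one beats the other. Hence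
  the mean of \<open>(D - 2\<^bsup>-k\<^esup>)\<^sup>2\<close> over all \<open>k\<close>-tuples, with those that are not transitive contributing \<open>0\<close>,
  is \<open>2 t\<^bsub>k+2\<^esub> - 2\<^bsup>1-k\<^esup> t\<^bsub>k+1\<^esub> + 4\<^bsup>-k\<^esup> t\<^sub>k\<close>, which is
  \<open>u\<^bsub>k+2\<^esub> - 2 u\<^bsub>k+1\<^esub> + u\<^sub>k\<close> up to a positive factor. So \<open>u\<close> is convex (\<open>convex_normalized_density\<close>),
  and since it starts with \<open>1, 1\<close>, it is nondecreasing and never below \<open>1\<close>.

  \<^bold>\<open>Equality.\<close> If \<open>u\<^sub>k\<close> is close to \<open>1\<close> for some \<open>k \<ge> 4\<close>, then so is \<open>u\<^sub>4\<close>. The squares above, for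
  \<open>k = 1, 2\<close>, show that almost all outdegrees are close to \<open>1/2\<close> and almost all common outdegrees
  of pairs to \<open>1/4\<close>: a Chung--Graham type condition which forces quasi-randomness. In detail,
  write \<open>b = a - 1/2\<close>. The mean square \<open>\<Gamma>\<close> of the entries of \<open>b b\<^sup>T\<close> is at most \<open>3/16 (u\<^sub>4 - 1)\<close>
  (\<open>irregularity_le\<close>), and two applications of the Cauchy--Schwarz inequality bound the fourth
  power of the cut norm of \<open>b\<close> by \<open>\<Gamma>\<close> (\<open>bilinear_bias_power4_le\<close>). Replacing the factors
  \<open>1/2 + b\<close> in the density of an arbitrary tournament by \<open>1/2\<close>, one at a time, changes it by at most the
  cut norm each time. As a fourth root is not linear, it is majorized by \<open>r + \<Gamma>/r\<^sup>3\<close> with arbitrary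
  \<open>r > 0\<close>; then the mean is taken, \<open>m\<close> tends to infinity and finally \<open>r\<close> to \<open>0\<close>.
\<close>

section \<open>Averages over a tournament kernel\<close>

text \<open>A weighted tournament with weight \<open>1/2\<close> on the diagonal (by \<open>complement\<close> with \<open>x = y\<close>).
  Thanks to the diagonal, the symmetrization in \<open>avg_complement\<close> holds exactly.\<close>
locale tournament_kernel =
  fixes V :: "'a set" and a :: "'a \<Rightarrow> 'a \<Rightarrow> real"
  assumes finite_V: "finite V" and nonempty_V: "V \<noteq> {}"
    and nonneg: "\<And>x y. x \<in> V \<Longrightarrow> y \<in> V \<Longrightarrow> 0 \<le> a x y"
    and complement: "\<And>x y. x \<in> V \<Longrightarrow> y \<in> V \<Longrightarrow> a x y + a y x = 1"
begin

definition avg :: "('a \<Rightarrow> real) \<Rightarrow> real" where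
  "avg f = (\<Sum>x\<in>V. f x) / card V"

definition tuple_avg :: "'i set \<Rightarrow> (('i \<Rightarrow> 'a) \<Rightarrow> real) \<Rightarrow> real" where
  "tuple_avg I f = (\<Sum>x\<in>I \<rightarrow>\<^sub>E V. f x) / card V ^ card I"

definition hom_density :: "'i set \<Rightarrow> ('i \<times> 'i) set \<Rightarrow> real" where
  "hom_density I F = tuple_avg I (\<lambda>x. \<Prod>(i, j)\<in>F. a (x i) (x j))"

lemma card_V_pos: "0 < card V"
  using finite_V nonempty_V by (simp add: card_gt_0_iff)

lemma le_1: "x \<in> V \<Longrightarrow> y \<in> V \<Longrightarrow> a x y \<le> 1"
  using complement[of x y] nonneg[of y x] by linarith

lemma avg_const [simp]: "avg (\<lambda>_. r) = r"
  using card_V_pos by (simp add: avg_def)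

lemma avg_add: "avg (\<lambda>x. f x + g x) = avg f + avg g"
  by (simp add: avg_def sum.distrib add_divide_distrib)

lemma avg_diff: "avg (\<lambda>x. f x - g x) = avg f - avg g"
  by (simp add: avg_def sum_subtractf diff_divide_distrib)

lemma avg_mult_left: "avg (\<lambda>x. r * f x) = r * avg f"
  by (simp add: avg_def sum_distrib_left)

lemma avg_mult_right: "avg (\<lambda>x. f x * r) = avg f * r"
  by (simp add: avg_def sum_distrib_right)

lemma avg_cong: "(\<And>x. x \<in> V \<Longrightarrow> f x = g x) \<Longrightarrow> avg f = avg g"
  by (simp add: avg_def)

lemma avg_mono: "(\<And>x. x \<in> V \<Longrightarrow> f x \<le> g x) \<Longrightarrow> avg f \<le> avg g"
  by (simp add: avg_def divide_right_mono sum_mono)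

lemma avg_nonneg: "(\<And>x. x \<in> V \<Longrightarrow> 0 \<le> f x) \<Longrightarrow> 0 \<le> avg f"
  by (simp add: avg_def sum_nonneg)

lemma avg_swap: "avg (\<lambda>x. avg (\<lambda>y. f x y)) = avg (\<lambda>y. avg (\<lambda>x. f x y))"
  unfolding avg_def sum_divide_distrib[symmetric] by (subst sum.swap) simp

lemma avg_mult_avg: "avg f * avg g = avg (\<lambda>x. avg (\<lambda>y. f x * g y))"
  by (simp only: avg_mult_left avg_mult_right)

lemma square_avg_le: "(avg f)\<^sup>2 \<le> avg (\<lambda>x. (f x)\<^sup>2)"
proof -
  have "0 \<le> avg (\<lambda>x. (f x - avg f)\<^sup>2)"
    by (rule avg_nonneg) simp
  also have "avg (\<lambda>x. (f x - avg f)\<^sup>2) = avg (\<lambda>x. ((f x)\<^sup>2 - (2 * avg f) * f x) + (avg f)\<^sup>2)"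
    by (rule avg_cong) (simp add: power2_eq_square algebra_simps)
  also have "\<dots> = avg (\<lambda>x. (f x)\<^sup>2) - (avg f)\<^sup>2"
    by (simp only: avg_add avg_diff avg_mult_left avg_const) (simp add: power2_eq_square)
  finally show ?thesis by simp
qed

lemma tuple_avg_empty [simp]: "tuple_avg {} f = f (\<lambda>_. undefined)"
  by (simp add: tuple_avg_def)

lemma tuple_avg_insert:
  assumes "finite I" "i \<notin> I"
  shows "tuple_avg (insert i I) f = tuple_avg I (\<lambda>x. avg (\<lambda>y. f (x(i := y))))"
proof -
  have "(\<Sum>x\<in>insert i I \<rightarrow>\<^sub>E V. f x) = (\<Sum>(y, x)\<in>V \<times> (I \<rightarrow>\<^sub>E V). f (x(i := y)))"
    unfolding PiE_insert_eq
    by (subst sum.reindex[OF inj_combinator[OF assms(2)]]) (simp add: case_prod_unfold)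
  also have "\<dots> = (\<Sum>x\<in>I \<rightarrow>\<^sub>E V. \<Sum>y\<in>V. f (x(i := y)))"
    by (subst sum.cartesian_product[symmetric], subst sum.swap) simp
  finally show ?thesis
    using assms by (simp add: tuple_avg_def avg_def sum_divide_distrib[symmetric])
qed

lemma tuple_avg_lessThan_Suc:
  "tuple_avg {..<Suc k} f = tuple_avg {..<k} (\<lambda>x. avg (\<lambda>y. f (x(k := y))))"
  unfolding lessThan_Suc by (rule tuple_avg_insert) auto

lemma tuple_avg_cong: "(\<And>x. x \<in> I \<rightarrow>\<^sub>E V \<Longrightarrow> f x = g x) \<Longrightarrow> tuple_avg I f = tuple_avg I g"
  by (simp add: tuple_avg_def)

lemma tuple_avg_add: "tuple_avg I (\<lambda>x. f x + g x) = tuple_avg I f + tuple_avg I g"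
  by (simp add: tuple_avg_def sum.distrib add_divide_distrib)

lemma tuple_avg_mult_left: "tuple_avg I (\<lambda>x. r * f x) = r * tuple_avg I f"
  by (simp add: tuple_avg_def sum_distrib_left)

lemma tuple_avg_nonneg: "(\<And>x. x \<in> I \<rightarrow>\<^sub>E V \<Longrightarrow> 0 \<le> f x) \<Longrightarrow> 0 \<le> tuple_avg I f"
  by (simp add: tuple_avg_def sum_nonneg)

lemma abs_tuple_avg_le:
  assumes "finite I" "\<And>x. x \<in> I \<rightarrow>\<^sub>E V \<Longrightarrow> \<bar>f x\<bar> \<le> r"
  shows "\<bar>tuple_avg I f\<bar> \<le> r"
proof -
  have c: "card (I \<rightarrow>\<^sub>E V) = card V ^ card I" using assms(1) by (simp add: card_PiE)
  have "\<bar>\<Sum>x\<in>I \<rightarrow>\<^sub>E V. f x\<bar> \<le> (\<Sum>x\<in>I \<rightarrow>\<^sub>E V. r)"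
    by (rule order_trans[OF sum_abs sum_mono]) (rule assms(2))
  also have "\<dots> = r * card V ^ card I" by (simp add: c)
  finally show ?thesis using card_V_pos by (simp add: tuple_avg_def pos_divide_le_eq)
qed

text \<open>Exchanging the two variables turns \<open>a x y\<close> into \<open>a y x\<close>, and the two weights add up to \<open>1\<close>.\<close>
lemma avg_complement:
  assumes "\<And>x y. x \<in> V \<Longrightarrow> y \<in> V \<Longrightarrow> G x y = G y x"
  shows "avg (\<lambda>x. avg (\<lambda>y. G x y * a x y)) = avg (\<lambda>x. avg (\<lambda>y. G x y)) / 2"
proof -
  let ?s = "avg (\<lambda>x. avg (\<lambda>y. G x y * a x y))"
  have "?s = avg (\<lambda>x. avg (\<lambda>y. G y x * a y x))" by (rule avg_swap)
  also have "\<dots> = avg (\<lambda>x. avg (\<lambda>y. G x y * a y x))"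
    by (intro avg_cong) (simp add: assms)
  finally have "?s + ?s = ?s + avg (\<lambda>x. avg (\<lambda>y. G x y * a y x))" by simp
  also have "\<dots> = avg (\<lambda>x. avg (\<lambda>y. G x y * (a x y + a y x)))"
    by (simp only: avg_add[symmetric] distrib_left)
  also have "\<dots> = avg (\<lambda>x. avg (\<lambda>y. G x y))"
    by (intro avg_cong) (simp add: complement)
  finally show ?thesis by simp
qed

section \<open>Transitive tuples: convexity of the normalized densities\<close>

definition transitive_weight :: "nat \<Rightarrow> (nat \<Rightarrow> 'a) \<Rightarrow> real" where
  "transitive_weight k x = (\<Prod>j<k. \<Prod>i<j. a (x i) (x j))"

definition transitive_density :: "nat \<Rightarrow> real" where
  "transitive_density k = tuple_avg {..<k} (transitive_weight k)"

definition common_outdegree :: "nat \<Rightarrow> (nat \<Rightarrow> 'a) \<Rightarrow> real" where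
  "common_outdegree k x = avg (\<lambda>y. \<Prod>i<k. a (x i) y)"

lemma transitive_weight_Suc:
  "transitive_weight (Suc k) x = transitive_weight k x * (\<Prod>i<k. a (x i) (x k))"
  by (simp add: transitive_weight_def)

lemma transitive_weight_upd: "k \<le> l \<Longrightarrow> transitive_weight k (x(l := y)) = transitive_weight k x"
  by (simp add: transitive_weight_def)

lemma transitive_weight_nonneg: "x \<in> {..<k} \<rightarrow>\<^sub>E V \<Longrightarrow> 0 \<le> transitive_weight k x"
  unfolding transitive_weight_def
  by (intro prod_nonneg ballI nonneg; meson PiE_mem lessThan_iff less_trans)

lemma transitive_density_eq_hom_density:
  "transitive_density k = hom_density {..<k} {(i, j). i < j \<and> j < k}"
proof -
  have "(\<Prod>(i, j)\<in>{(i, j). i < j \<and> j < k}. a (x i) (x j)) = transitive_weight k x" for x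
  proof -
    have "transitive_weight k x = (\<Prod>(j, i)\<in>(SIGMA j:{..<k}. {..<j}). a (x i) (x j))"
      unfolding transitive_weight_def by (subst prod.Sigma) auto
    also have "\<dots> = (\<Prod>(i, j)\<in>{(i, j). i < j \<and> j < k}. a (x i) (x j))"
      by (rule prod.reindex_bij_witness[of _ prod.swap prod.swap]) auto
    finally show ?thesis by simp
  qed
  then show ?thesis by (simp add: transitive_density_def hom_density_def)
qed

lemma transitive_density_Suc:
  "transitive_density (Suc k) =
     tuple_avg {..<k} (\<lambda>x. transitive_weight k x * common_outdegree k x)"
proof -
  have "(\<Prod>i<k. a ((x(k := y)) i) y) = (\<Prod>i<k. a (x i) y)" for x y
    by (rule prod.cong) auto
  then show ?thesis
    unfolding transitive_density_def lessThan_Suc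
    by (subst tuple_avg_insert)
      (simp_all add: transitive_weight_Suc transitive_weight_upd avg_mult_left common_outdegree_def)
qed

text \<open>The last two vertices are drawn independently from the common out-neighbourhood of the first
  \<open>k\<close>, and the weight of the arc between them is \<open>1/2\<close> by symmetry.\<close>
lemma transitive_density_Suc_Suc:
  "transitive_density (Suc (Suc k)) =
     tuple_avg {..<k} (\<lambda>x. transitive_weight k x * (common_outdegree k x)\<^sup>2 / 2)"
proof -
  have p: "(\<Prod>i<k. a ((x(k := y)) i) z) = (\<Prod>i<k. a (x i) z)" for x y z
    by (rule prod.cong) auto
  have c: "common_outdegree (Suc k) (x(k := y)) = avg (\<lambda>z. (\<Prod>i<k. a (x i) z) * a y z)" for x y
    by (simp add: common_outdegree_def p)
  have s: "avg (\<lambda>y. (\<Prod>i<k. a (x i) y) * avg (\<lambda>z. (\<Prod>i<k. a (x i) z) * a y z)) =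
      (common_outdegree k x)\<^sup>2 / 2" for x
  proof -
    let ?g = "\<lambda>y. \<Prod>i<k. a (x i) y"
    have "avg (\<lambda>y. ?g y * avg (\<lambda>z. ?g z * a y z)) = avg (\<lambda>y. avg (\<lambda>z. (?g y * ?g z) * a y z))"
      by (simp only: avg_mult_left[symmetric] mult.assoc)
    also have "\<dots> = avg (\<lambda>y. avg (\<lambda>z. ?g y * ?g z)) / 2"
      by (rule avg_complement) simp
    finally show ?thesis
      by (simp add: common_outdegree_def power2_eq_square avg_mult_avg)
  qed
  show ?thesis
    unfolding transitive_density_Suc[of "Suc k"] lessThan_Suc
    by (subst tuple_avg_insert)
      (simp_all only: finite_lessThan lessThan_iff less_irrefl not_False_eq_True
        transitive_weight_Suc transitive_weight_upd order_refl fun_upd_same p c mult.assoc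
        avg_mult_left s times_divide_eq_right)
qed

text \<open>The value is \<open>1\<close> in the quasi-random case.\<close>
definition normalized_density :: "nat \<Rightarrow> real" where
  "normalized_density k = 2 ^ (k choose 2) * transitive_density k"

text \<open>The square of \<open>D - 2\<^bsup>-k\<^esup>\<close> expands into the densities of orders \<open>k\<close>, \<open>k + 1\<close> and \<open>k + 2\<close>. The
  centre \<open>2\<^bsup>-k\<^esup>\<close> is the quasi-random value of the common outdegree \<open>D\<close>; with it, all three
  coefficients are matched by the normalization.\<close>
lemma second_difference:
  "normalized_density (Suc (Suc k)) - 2 * normalized_density (Suc k) + normalized_density k =
     2 ^ (k choose 2) * 4 ^ k *
       tuple_avg {..<k} (\<lambda>x. transitive_weight k x * (common_outdegree k x - 1 / 2 ^ k)\<^sup>2)"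
proof -
  let ?T = "tuple_avg {..<k} (\<lambda>x. transitive_weight k x * (common_outdegree k x - 1 / 2 ^ k)\<^sup>2)"
  have "?T = tuple_avg {..<k} (\<lambda>x. (2 * (transitive_weight k x * (common_outdegree k x)\<^sup>2 / 2) +
      (- 2 / 2 ^ k) * (transitive_weight k x * common_outdegree k x)) +
      (1 / 2 ^ k)\<^sup>2 * transitive_weight k x)"
    by (rule tuple_avg_cong) (simp add: power2_eq_square algebra_simps)
  also have "\<dots> = 2 * transitive_density (Suc (Suc k)) - 2 / 2 ^ k * transitive_density (Suc k) +
      (1 / 2 ^ k)\<^sup>2 * transitive_density k"
    unfolding tuple_avg_add tuple_avg_mult_left transitive_density_Suc_Suc
      transitive_density_Suc[symmetric]
    by (simp add: transitive_density_def)
  finally have T: "?T = 2 * transitive_density (Suc (Suc k)) -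
      2 / 2 ^ k * transitive_density (Suc k) + (1 / 2 ^ k)\<^sup>2 * transitive_density k" .
  have c: "Suc k choose 2 = k + (k choose 2)" "Suc (Suc k) choose 2 = Suc (2 * k + (k choose 2))"
    by (simp_all add: numeral_2_eq_2)
  have f: "(4::real) ^ k = 2 ^ k * 2 ^ k" by (simp add: power_mult_distrib[symmetric])
  have g: "(2::real) ^ (2 * k) = 2 ^ k * 2 ^ k" by (simp add: power_mult f)
  have "2 * (q * q * r) * t2 - 2 * (q * r * t1) + r * t0 =
      r * (q * q) * (2 * t2 - 2 / q * t1 + (1 / q)\<^sup>2 * t0)"
    if "q \<noteq> 0" for q r t0 t1 t2 :: real
    using that by (simp add: power2_eq_square field_simps)
  from this[of "2 ^ k"] show ?thesis
    unfolding T normalized_density_def c power_Suc power_add g f by simp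
qed

lemma normalized_density_0: "normalized_density 0 = 1"
  by (simp add: normalized_density_def transitive_density_def transitive_weight_def
      binomial_eq_0)

lemma normalized_density_1: "normalized_density (Suc 0) = 1"
  by (simp add: normalized_density_def transitive_density_Suc common_outdegree_def
      transitive_weight_def binomial_eq_0)

lemma normalized_density_2: "normalized_density (Suc (Suc 0)) = 1"
  by (simp add: normalized_density_def transitive_density_Suc_Suc common_outdegree_def
      transitive_weight_def, simp flip: numeral_2_eq_2)

lemma convex_normalized_density:
  "normalized_density (Suc k) - normalized_density k
     \<le> normalized_density (Suc (Suc k)) - normalized_density (Suc k)"
proof -
  have "0 \<le> tuple_avg {..<k} (\<lambda>x. transitive_weight k x * (common_outdegree k x - 1 / 2 ^ k)\<^sup>2)"
    by (intro tuple_avg_nonneg mult_nonneg_nonneg transitive_weight_nonneg) auto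
  then have "0 \<le> normalized_density (Suc (Suc k)) - 2 * normalized_density (Suc k)
      + normalized_density k"
    unfolding second_difference by simp
  then show ?thesis by simp
qed

text \<open>A convex sequence whose first step is \<open>0\<close> is nondecreasing.\<close>
lemma mono_normalized_density: "mono normalized_density"
proof -
  have "0 \<le> normalized_density (Suc k) - normalized_density k" for k
  proof (induction k)
    case (Suc k)
    then show ?case using convex_normalized_density[of k] by linarith
  qed (simp add: normalized_density_0 normalized_density_1)
  then show ?thesis by (simp add: mono_iff_le_Suc)
qed

lemma normalized_density_ge_1: "1 \<le> normalized_density k"
  using monoD[OF mono_normalized_density le0[of k]] unfolding normalized_density_0 .

end

section \<open>Near-equality forces all densities to be near quasi-random\<close>

text \<open>A bound for the fourth root that is linear in \<open>G\<close>, so that it can be averaged.\<close>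
lemma abs_le_of_power4_le:
  fixes t :: real
  assumes "t ^ 4 \<le> G" "0 < r"
  shows "\<bar>t\<bar> \<le> r + G / r ^ 3"
proof -
  have "0 \<le> t ^ 4" by simp
  then have G: "0 \<le> G" using assms(1) by linarith
  show ?thesis
  proof (cases "\<bar>t\<bar> \<le> r")
    case True
    then show ?thesis using G assms(2) by (simp add: add_increasing2)
  next
    case False
    then have "\<bar>t\<bar> * r ^ 3 \<le> \<bar>t\<bar> * \<bar>t\<bar> ^ 3"
      using assms(2) by (intro mult_left_mono power_mono) auto
    also have "\<dots> = t ^ 4" by (simp add: power_abs[symmetric] abs_mult[symmetric] eval_nat_numeral)
    finally have "\<bar>t\<bar> * r ^ 3 \<le> G" using assms(1) by linarith
    then have "\<bar>t\<bar> \<le> G / r ^ 3" using assms(2) by (simp add: pos_le_divide_eq)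
    then show ?thesis using assms(2) by linarith
  qed
qed

context tournament_kernel
begin

definition bias :: "'a \<Rightarrow> 'a \<Rightarrow> real" where
  "bias x y = a x y - 1 / 2"

text \<open>The entries of \<open>b b\<^sup>T\<close>, where \<open>b\<close> is the matrix of biases; \<open>irregularity\<close> is the mean of
  their squares.\<close>
definition bias_covariance :: "'a \<Rightarrow> 'a \<Rightarrow> real" where
  "bias_covariance y z = avg (\<lambda>x. bias y x * bias z x)"

definition irregularity :: real where
  "irregularity = avg (\<lambda>y. avg (\<lambda>z. (bias_covariance y z)\<^sup>2))"

text \<open>An entry of \<open>b b\<^sup>T\<close> is a combination of the deviations of one common outdegree from \<open>1/4\<close>
  and of two outdegrees from \<open>1/2\<close>. Up to constant factors, their mean squares are the
  second differences of the normalized densities at \<open>k = 2\<close> and at \<open>k = 1\<close>; with the weights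
  obtained here, the order \<open>3\<close> term cancels.\<close>
lemma irregularity_le: "irregularity \<le> 3 / 16 * (normalized_density 4 - 1)"
proof -
  define d where "d y = avg (a y)" for y
  define c where "c y z = avg (\<lambda>x. a y x * a z x)" for y z
  have "normalized_density (Suc (Suc 1)) - 2 * normalized_density (Suc 1) + normalized_density 1 =
      4 * avg (\<lambda>y. (d y - 1 / 2)\<^sup>2)"
    unfolding second_difference
    by (simp add: tuple_avg_lessThan_Suc transitive_weight_def common_outdegree_def d_def
        binomial_eq_0)
  then have u3: "avg (\<lambda>y. (d y - 1 / 2)\<^sup>2) = (normalized_density 3 - 1) / 4"
    using normalized_density_1 normalized_density_2 by (simp add: eval_nat_numeral)
  have sym: "avg (\<lambda>y. avg (\<lambda>z. (c y z - 1 / 4)\<^sup>2 * a y z)) = avg (\<lambda>y. avg (\<lambda>z. (c y z - 1 / 4)\<^sup>2)) / 2"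
    by (rule avg_complement) (simp add: c_def mult.commute)
  have "tuple_avg {..<2} f = avg (\<lambda>y. avg (\<lambda>z. f ((\<lambda>_. undefined)(0 := y, 1 := z))))"
    for f :: "(nat \<Rightarrow> 'a) \<Rightarrow> real"
    unfolding numeral_2_eq_2 tuple_avg_lessThan_Suc by simp
  moreover have "transitive_weight 2 x = a (x 0) (x 1)"
    "common_outdegree 2 x = avg (\<lambda>z. a (x 0) z * a (x 1) z)" for x
    by (simp_all add: transitive_weight_def common_outdegree_def numeral_2_eq_2)
  ultimately have "normalized_density (Suc (Suc 2)) - 2 * normalized_density (Suc 2) + normalized_density 2 =
      32 * avg (\<lambda>y. avg (\<lambda>z. (c y z - 1 / 4)\<^sup>2 * a y z))"
    unfolding second_difference by (simp add: c_def mult.commute)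
  with sym have u4: "avg (\<lambda>y. avg (\<lambda>z. (c y z - 1 / 4)\<^sup>2)) =
      (normalized_density 4 - 2 * normalized_density 3 + 1) / 16"
    using normalized_density_2 by (simp add: eval_nat_numeral)
  have cov: "bias_covariance y z = (c y z - 1 / 4) - (d y - 1 / 2) / 2 - (d z - 1 / 2) / 2" for y z
  proof -
    have "bias_covariance y z = avg (\<lambda>x. ((a y x * a z x - 1 / 2 * a y x) - 1 / 2 * a z x) + 1 / 4)"
      unfolding bias_covariance_def bias_def by (rule avg_cong) (simp add: algebra_simps)
    also have "\<dots> = c y z - 1 / 2 * d y - 1 / 2 * d z + 1 / 4"
      by (simp only: avg_add avg_diff avg_mult_left avg_const c_def d_def)
    finally show ?thesis by (simp add: field_simps)
  qed
  have "irregularity \<le> avg (\<lambda>y. avg (\<lambda>z.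
      3 * (c y z - 1 / 4)\<^sup>2 + (3 / 4 * (d y - 1 / 2)\<^sup>2 + 3 / 4 * (d z - 1 / 2)\<^sup>2)))"
    unfolding irregularity_def
  proof (intro avg_mono)
    fix y z
    have "(p - q / 2 - r / 2)\<^sup>2 \<le> 3 * p\<^sup>2 + (3 / 4 * q\<^sup>2 + 3 / 4 * r\<^sup>2)" for p q r :: real
    proof -
      \<comment> \<open>Lagrange's identity behind the Cauchy--Schwarz bound \<open>(p + q' + r')\<^sup>2 \<le> 3 (p\<^sup>2 + q'\<^sup>2 + r'\<^sup>2)\<close>\<close>
      have "0 \<le> (p + q / 2)\<^sup>2 + (p + r / 2)\<^sup>2 + (q / 2 - r / 2)\<^sup>2" by simp
      then show ?thesis by (simp add: power2_eq_square algebra_simps)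
    qed
    then show "(bias_covariance y z)\<^sup>2
        \<le> 3 * (c y z - 1 / 4)\<^sup>2 + (3 / 4 * (d y - 1 / 2)\<^sup>2 + 3 / 4 * (d z - 1 / 2)\<^sup>2)"
      unfolding cov .
  qed
  also have "\<dots> = 3 * avg (\<lambda>y. avg (\<lambda>z. (c y z - 1 / 4)\<^sup>2)) + 3 / 2 * avg (\<lambda>y. (d y - 1 / 2)\<^sup>2)"
    by (simp only: avg_add avg_mult_left avg_const)
  also have "\<dots> = 3 / 16 * (normalized_density 4 - 1)"
    unfolding u3 u4 by (simp add: field_simps)
  finally show ?thesis .
qed

text \<open>Each application of \<open>square_avg_le\<close> removes one of the two test functions: the first one leaves a
  quadratic form in \<open>g\<close> with matrix \<open>b\<^sup>T b = b b\<^sup>T\<close> (as \<open>b\<close> is antisymmetric), the second one the mean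
  square of that matrix.\<close>
lemma bilinear_bias_power4_le:
  assumes "\<And>x. x \<in> V \<Longrightarrow> \<bar>f x\<bar> \<le> 1" "\<And>x. x \<in> V \<Longrightarrow> \<bar>g x\<bar> \<le> 1"
  shows "(avg (\<lambda>x. avg (\<lambda>y. f x * g y * bias x y))) ^ 4 \<le> irregularity"
proof -
  let ?h = "\<lambda>x. avg (\<lambda>y. g y * bias x y)"
  let ?X = "avg (\<lambda>x. avg (\<lambda>y. f x * g y * bias x y))"
  let ?Y = "avg (\<lambda>y. avg (\<lambda>z. g y * g z * bias_covariance y z))"
  have "?X\<^sup>2 = (avg (\<lambda>x. f x * ?h x))\<^sup>2"
    by (simp only: mult.assoc avg_mult_left)
  also have "\<dots> \<le> avg (\<lambda>x. (f x * ?h x)\<^sup>2)"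
    by (rule square_avg_le)
  also have "\<dots> \<le> avg (\<lambda>x. (?h x)\<^sup>2)"
    using assms(1) by (intro avg_mono) (simp add: power_mult_distrib mult_left_le_one_le abs_square_le_1)
  also have "\<dots> = avg (\<lambda>x. avg (\<lambda>y. avg (\<lambda>z. (g y * bias x y) * (g z * bias x z))))"
    by (simp only: power2_eq_square avg_mult_avg)
  also have "\<dots> = avg (\<lambda>y. avg (\<lambda>x. avg (\<lambda>z. (g y * bias x y) * (g z * bias x z))))"
    by (rule avg_swap)
  also have "\<dots> = avg (\<lambda>y. avg (\<lambda>z. avg (\<lambda>x. (g y * bias x y) * (g z * bias x z))))"
    by (intro avg_cong avg_swap)
  also have "\<dots> = avg (\<lambda>y. avg (\<lambda>z. avg (\<lambda>x. g y * g z * (bias y x * bias z x))))"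
  proof (intro avg_cong)
    fix x y z assume "x \<in> V" "y \<in> V" "z \<in> V"
    then have "bias x y = - bias y x" "bias x z = - bias z x"
      using complement[of x y] complement[of x z] by (auto simp: bias_def)
    then show "(g y * bias x y) * (g z * bias x z) = g y * g z * (bias y x * bias z x)" by simp
  qed
  also have "\<dots> = ?Y" by (simp only: bias_covariance_def avg_mult_left)
  finally have XY: "?X\<^sup>2 \<le> ?Y" .
  have "?X ^ 4 = (?X\<^sup>2)\<^sup>2" by (simp flip: power_mult)
  also have "\<dots> \<le> ?Y\<^sup>2" using XY by (intro power_mono) auto
  also have "\<dots> \<le> avg (\<lambda>y. (avg (\<lambda>z. g y * g z * bias_covariance y z))\<^sup>2)"
    by (rule square_avg_le)
  also have "\<dots> \<le> avg (\<lambda>y. avg (\<lambda>z. (g y * g z * bias_covariance y z)\<^sup>2))"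
    by (intro avg_mono square_avg_le)
  also have "\<dots> \<le> irregularity"
    unfolding irregularity_def
  proof (intro avg_mono)
    fix y z assume "y \<in> V" "z \<in> V"
    then have "(g y * g z)\<^sup>2 \<le> 1"
      using assms(2) by (simp add: abs_square_le_1 abs_mult mult_le_one)
    then show "(g y * g z * bias_covariance y z)\<^sup>2 \<le> (bias_covariance y z)\<^sup>2"
      by (simp add: power_mult_distrib[of "g y * g z"] mult_left_le_one_le)
  qed
  finally show ?thesis .
qed

definition arc_product :: "('i \<times> 'i) set \<Rightarrow> ('i \<Rightarrow> 'a) \<Rightarrow> real" where
  "arc_product F x = (\<Prod>(i, j)\<in>F. a (x i) (x j))"

lemma hom_density_arc_product: "hom_density I F = tuple_avg I (arc_product F)"
  by (simp add: hom_density_def arc_product_def[abs_def])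

lemma arc_product_bounds:
  assumes "F \<subseteq> I \<times> I" "\<And>i. i \<in> I \<Longrightarrow> x i \<in> V"
  shows "0 \<le> arc_product F x \<and> arc_product F x \<le> 1"
  unfolding arc_product_def
  using assms by (auto intro!: prod_nonneg prod_le_1 nonneg le_1)

lemma arc_product_cong:
  assumes "\<And>i j. (i, j) \<in> F \<Longrightarrow> x i = y i \<and> x j = y j"
  shows "arc_product F x = arc_product F y"
  unfolding arc_product_def using assms by (intro prod.cong) auto

text \<open>Fixing the images of all indices except \<open>u\<close> and \<open>v\<close>, the product over \<open>F\<close> splits into a function
  of the image of \<open>u\<close> and one of the image of \<open>v\<close>, because no arc of \<open>F\<close> joins \<open>u\<close> and \<open>v\<close>. So the
  contribution of the bias on the new arc \<open>(u, v)\<close> is a bilinear form in the biases, with test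
  functions bounded by \<open>1\<close>.\<close>
lemma hom_density_insert:
  assumes I: "finite I" "u \<in> I" "v \<in> I" "u \<noteq> v" and F: "finite F" "F \<subseteq> I \<times> I"
    and uv: "(u, v) \<notin> F" "(v, u) \<notin> F" and r: "0 < r"
  shows "\<bar>hom_density I (insert (u, v) F) - hom_density I F / 2\<bar> \<le> r + irregularity / r ^ 3"
proof -
  define J where "J = I - {u, v}"
  have J: "finite J" "u \<notin> insert v J" "v \<notin> J" "I = insert u (insert v J)"
    using I by (auto simp: J_def)
  define E where "E = {(i, j) \<in> F. i = u \<or> j = u}"
  have E: "E \<subseteq> F" "E \<subseteq> (I - {v}) \<times> (I - {v})" "F - E \<subseteq> (I - {u}) \<times> (I - {u})"
    using uv F(2) I(4) by (auto simp: E_def)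
  \<comment> \<open>\<open>E\<close> collects the arcs at \<open>u\<close>: they avoid \<open>v\<close>, and the remaining arcs avoid \<open>u\<close>.\<close>
  have "hom_density I (insert (u, v) F) - hom_density I F / 2 =
      tuple_avg I (\<lambda>x. arc_product (insert (u, v) F) x + (- 1 / 2) * arc_product F x)"
    unfolding tuple_avg_add tuple_avg_mult_left hom_density_arc_product by simp
  also have "\<dots> = tuple_avg I (\<lambda>x. arc_product F x * bias (x u) (x v))"
    using F(1) uv(1) by (simp add: arc_product_def bias_def algebra_simps)
  also have "\<dots> = tuple_avg J (\<lambda>x. avg (\<lambda>q. avg (\<lambda>p. arc_product F (x(v := q, u := p)) * bias p q)))"
    unfolding J(4) using J(1-3) I(4) by (simp add: tuple_avg_insert)
  also have "\<bar>\<dots>\<bar> \<le> r + irregularity / r ^ 3"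
  proof (rule abs_tuple_avg_le[OF J(1)])
    fix x assume "x \<in> J \<rightarrow>\<^sub>E V"
    then have x: "x i \<in> V" if "i \<in> I - {u, v}" for i using that by (auto simp: J_def)
    let ?f = "\<lambda>p. arc_product E (x(u := p))" and ?g = "\<lambda>q. arc_product (F - E) (x(v := q))"
    have split: "arc_product F (x(v := q, u := p)) = ?f p * ?g q" for p q
    proof -
      have "arc_product F (x(v := q, u := p)) =
          arc_product (F - E) (x(v := q, u := p)) * arc_product E (x(v := q, u := p))"
        unfolding arc_product_def by (rule prod.subset_diff[OF E(1) F(1)])
      moreover have "arc_product (F - E) (x(v := q, u := p)) = ?g q"
        using E(3) by (intro arc_product_cong) auto
      moreover have "arc_product E (x(v := q, u := p)) = ?f p"
        using E(2) by (intro arc_product_cong) auto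
      ultimately show ?thesis by simp
    qed
    have "avg (\<lambda>q. avg (\<lambda>p. arc_product F (x(v := q, u := p)) * bias p q)) =
        avg (\<lambda>p. avg (\<lambda>q. ?f p * ?g q * bias p q))"
      unfolding split by (rule avg_swap)
    moreover have "(avg (\<lambda>p. avg (\<lambda>q. ?f p * ?g q * bias p q))) ^ 4 \<le> irregularity"
    proof (rule bilinear_bias_power4_le)
      fix p assume "p \<in> V"
      then show "\<bar>?f p\<bar> \<le> 1"
        using arc_product_bounds[OF E(2), of "x(u := p)"] x by simp
    next
      fix q assume "q \<in> V"
      then show "\<bar>?g q\<bar> \<le> 1"
        using arc_product_bounds[OF E(3), of "x(v := q)"] x by simp
    qed
    ultimately show "\<bar>avg (\<lambda>q. avg (\<lambda>p. arc_product F (x(v := q, u := p)) * bias p q))\<bar>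
        \<le> r + irregularity / r ^ 3"
      using r by (simp add: abs_le_of_power4_le)
  qed
  finally show ?thesis .
qed

lemma hom_density_near_quasirandom:
  assumes I: "finite I" and F: "F \<subseteq> I \<times> I" "asym F" and r: "0 < r"
  shows "\<bar>hom_density I F - 1 / 2 ^ card F\<bar> \<le> card F * (r + irregularity / r ^ 3)"
proof -
  have "finite F" using I F(1) finite_subset by blast
  then show ?thesis using F
  proof (induction F rule: finite_induct)
    case empty
    have "hom_density I {} = 1"
      using I card_V_pos by (simp add: hom_density_def tuple_avg_def card_PiE)
    then show ?case by simp
  next
    case (insert e F)
    obtain u v where e: "e = (u, v)" by (cases e)
    have as: "asym F" "(v, u) \<notin> insert (u, v) F"
      using insert.prems(2) unfolding e asym_iff by blast+
    let ?R = "r + irregularity / r ^ 3"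
    have "\<bar>hom_density I (insert e F) - hom_density I F / 2\<bar> \<le> ?R"
      unfolding e by (rule hom_density_insert[OF I]) (use insert as r in \<open>auto simp: e\<close>)
    moreover have "\<bar>hom_density I F - 1 / 2 ^ card F\<bar> \<le> card F * ?R"
      using insert as by auto
    moreover have "\<bar>h - q / 2\<bar> \<le> R + S" if "\<bar>h - h' / 2\<bar> \<le> R" "\<bar>h' - q\<bar> \<le> S" for h h' q R S :: real
      using that by (smt (verit) field_sum_of_halves)
    ultimately have "\<bar>hom_density I (insert e F) - 1 / 2 ^ card F / 2\<bar> \<le> ?R + card F * ?R"
      by blast
    then show ?case using insert.hyps by (simp add: distrib_right)
  qed
qed

text \<open>The bound is affine in the normalized density of the transitive tournament, which is what
  allows it to be averaged over tournaments.\<close>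
lemma hom_density_near_quasirandom_of_transitive_density:
  assumes "finite I" "F \<subseteq> I \<times> I" "asym F" "0 < r" "4 \<le> k"
  shows "\<bar>hom_density I F - 1 / 2 ^ card F\<bar> \<le>
    card F * (r + 3 / 16 * (normalized_density k - 1) / r ^ 3)"
proof -
  have "irregularity \<le> 3 / 16 * (normalized_density k - 1)"
    using irregularity_le monoD[OF mono_normalized_density assms(5)] by simp
  then have "card F * (r + irregularity / r ^ 3)
      \<le> card F * (r + 3 / 16 * (normalized_density k - 1) / r ^ 3)"
    using assms(4) by (intro mult_left_mono add_left_mono divide_right_mono) auto
  with hom_density_near_quasirandom[OF assms(1-4)] show ?thesis by linarith
qed

end

section \<open>Subtournament densities and kernel densities\<close>

definition arc_kernel :: "('a \<times> 'a) set \<Rightarrow> 'a \<Rightarrow> 'a \<Rightarrow> real" where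
  "arc_kernel A x y = (if x = y then 1 / 2 else of_bool ((x, y) \<in> A))"

lemma tournament_kernel_arc_kernel:
  assumes "tournament V A" "V \<noteq> {}"
  shows "tournament_kernel V (arc_kernel A)"
  using assms by unfold_locales (auto simp: arc_kernel_def tournament_alt)

definition embeddings :: "'b set \<Rightarrow> ('b \<times> 'b) set \<Rightarrow> 'a set \<Rightarrow> ('a \<times> 'a) set \<Rightarrow> ('b \<Rightarrow> 'a) set" where
  "embeddings W B V A = {f \<in> W \<rightarrow>\<^sub>E V. inj_on f W \<and> (\<forall>(i, j)\<in>B. (f i, f j) \<in> A)}"

text \<open>An injection that preserves arcs also reflects them, since of two opposite arcs a tournament
  contains only one.\<close>
lemma embeddings_iso_iff:
  assumes "tournament W B" "tournament V A" "inj_on f W" "f ` W = S" "S \<subseteq> V"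
  shows "(\<forall>(i, j)\<in>B. (f i, f j) \<in> A) \<longleftrightarrow> tournament_iso f (W, B) (S, Restr A S)"
proof
  assume arcs: "\<forall>(i, j)\<in>B. (f i, f j) \<in> A"
  have "(i, j) \<in> B \<longleftrightarrow> (f i, f j) \<in> Restr A S" if "i \<in> W" "j \<in> W" for i j
  proof
    assume "(f i, f j) \<in> Restr A S"
    then have "(f j, f i) \<notin> A" and "i \<noteq> j" using assms(2) by (auto simp: tournament_alt)
    moreover have "(i, j) \<in> B \<or> (j, i) \<in> B"
      using assms(1) that \<open>i \<noteq> j\<close> by (simp add: tournament_alt)
    ultimately show "(i, j) \<in> B" using arcs by blast
  qed (use arcs that assms in auto)
  then show "tournament_iso f (W, B) (S, Restr A S)"
    using assms by (simp add: tournament_iso_def bij_betw_def)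
next
  assume "tournament_iso f (W, B) (S, Restr A S)"
  then show "\<forall>(i, j)\<in>B. (f i, f j) \<in> A"
    using assms(1) by (auto simp: tournament_iso_def tournament_def)
qed

lemma num_auts_tclass_of:
  assumes "tournament W B"
  shows "num_auts (tclass_of W B) = card (tournament_isos (W, B) (W, B))"
  using assms unfolding tclass_of_def
  by (subst num_auts.abs_eq) (auto simp: isomorphic_tournaments_def intro: tournament_iso_id)

lemma finite_tournament_isos:
  assumes "finite V" "finite W"
  shows "finite (tournament_isos (V, A) (W, B))"
  by (rule finite_subset[OF _ finite_PiE[of V "\<lambda>_. W"]])
    (use assms in \<open>auto simp: tournament_isos_def tournament_iso_def PiE_def bij_betw_def\<close>)

text \<open>Embeddings are grouped by their image; each image isomorphic to \<open>(W, B)\<close> is hit by as many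
  of them as \<open>(W, B)\<close> has automorphisms.\<close>
lemma card_embeddings:
  fixes V W :: "nat set"
  assumes W: "tournament W B" and V: "tournament V A"
  shows "card (embeddings W B V A) = num_auts (tclass_of W B) *
    card {S. S \<subseteq> V \<and> card S = card W \<and> induced A S = tclass_of W B}"
proof -
  let ?SS = "{S. S \<subseteq> V \<and> card S = card W \<and> induced A S = tclass_of W B}"
  let ?iso = "\<lambda>S. tournament_isos (W, B) (S, Restr A S)"
  have finV: "finite V" and finW: "finite W" using V W by (auto simp: tournament_def)
  have SV: "S \<subseteq> V" if "S \<in> ?SS" for S using that by simp
  have iso_class: "induced A S = tclass_of W B \<longleftrightarrow> (\<exists>f. tournament_iso f (W, B) (S, Restr A S))"
    if "S \<subseteq> V" for S
    using tclass_of_eq_iff[OF W tournament_Restr[OF V that]] by (auto simp: induced_def)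
  have cardW: "card S = card W" if "tournament_iso f (W, B) (S, C)" for f S C
    using that bij_betw_same_card by (fastforce simp: tournament_iso_def)
  have card_iso: "card (?iso S) = num_auts (tclass_of W B)" if "S \<in> ?SS" for S
  proof -
    from that iso_class[of S] obtain f where "tournament_iso f (W, B) (S, Restr A S)" by auto
    then show ?thesis
      unfolding num_auts_tclass_of[OF W] by (rule card_tournament_isos_right[symmetric])
  qed
  have "embeddings W B V A = (\<Union>S\<in>?SS. ?iso S)"
  proof (intro equalityI subsetI)
    fix f assume f: "f \<in> embeddings W B V A"
    then have "f ` W \<subseteq> V" by (auto simp: embeddings_def)
    moreover from this have iso: "tournament_iso f (W, B) (f ` W, Restr A (f ` W))"
      using f embeddings_iso_iff[OF W V, of f "f ` W"] by (simp add: embeddings_def)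
    ultimately have "f ` W \<in> ?SS" using iso_class cardW by blast
    moreover have "f \<in> ?iso (f ` W)"
      using f iso by (simp add: embeddings_def tournament_isos_def PiE_def)
    ultimately show "f \<in> (\<Union>S\<in>?SS. ?iso S)" by blast
  next
    fix f assume "f \<in> (\<Union>S\<in>?SS. ?iso S)"
    then obtain S where S: "S \<subseteq> V" "f \<in> extensional W" "tournament_iso f (W, B) (S, Restr A S)"
      by (auto simp: tournament_isos_def)
    then have "inj_on f W" "f ` W = S" by (auto simp: tournament_iso_def bij_betw_def)
    then show "f \<in> embeddings W B V A"
      using S embeddings_iso_iff[OF W V, of f S] by (auto simp: embeddings_def PiE_def)
  qed
  moreover have "?iso S \<inter> ?iso S' = {}" if "S \<noteq> S'" for S S'
    using that by (auto simp: tournament_isos_def tournament_iso_def bij_betw_def)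
  moreover have "finite ?SS" using finV by simp
  moreover have "finite (?iso S)" if "S \<in> ?SS" for S
    using finV finW SV[OF that] by (simp add: finite_tournament_isos finite_subset)
  ultimately have "card (embeddings W B V A) = (\<Sum>S\<in>?SS. card (?iso S))"
    by (simp add: card_UN_disjoint)
  also have "\<dots> = card ?SS * num_auts (tclass_of W B)" using card_iso by simp
  finally show ?thesis by simp
qed

lemma falling_factorial:
  "real (fact l * (m choose l)) = (\<Prod>i<l. real m - real i)"
  using gbinomial_mult_fact[of l "real m"] by (simp add: binomial_gbinomial atLeast0LessThan)

lemma card_injections:
  assumes "finite W" "finite V"
  shows "card {f \<in> W \<rightarrow>\<^sub>E V. inj_on f W} = fact (card W) * (card V choose card W)"
proof -
  have "card {f \<in> W \<rightarrow>\<^sub>E V. inj_on f W} = (\<Prod>i<card W. card V - i)"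
    using card_inj_on_subset_funcset[OF assms subset_refl] by (simp add: atLeast0LessThan)
  also have "\<dots> = fact (card W) * (card V choose card W)"
  proof (cases "card W \<le> card V")
    case True
    then have "real (\<Prod>i<card W. card V - i) = (\<Prod>i<card W. real (card V) - real i)"
      unfolding of_nat_prod by (intro prod.cong) (auto simp: of_nat_diff)
    then show ?thesis using falling_factorial[of "card W" "card V"] by linarith
  next
    case False
    then have "(\<Prod>i<card W. card V - i) = 0" by (auto intro!: bexI[of _ "card V"])
    then show ?thesis using False by (simp add: binomial_eq_0)
  qed
  finally show ?thesis .
qed

lemma injective_ratio_tendsto_1:
  "(\<lambda>m. fact l * (m choose l) / real m ^ l) \<longlonglongrightarrow> 1"
proof -
  have "(\<lambda>m. \<Prod>i<l. 1 - real i / real m) \<longlonglongrightarrow> (\<Prod>i<l. 1 - 0)"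
    by (intro tendsto_intros lim_const_over_n)
  then have "(\<lambda>m. \<Prod>i<l. 1 - real i / real m) \<longlonglongrightarrow> 1" by simp
  moreover have "\<forall>\<^sub>F m in sequentially. (\<Prod>i<l. 1 - real i / real m) =
      fact l * (m choose l) / real m ^ l"
    using eventually_gt_at_top[of 0]
  proof eventually_elim
    case (elim m)
    then have "(\<Prod>i<l. 1 - real i / real m) = (\<Prod>i<l. (real m - real i) / real m)"
      by (simp add: diff_divide_distrib)
    also have "\<dots> = real (fact l * (m choose l)) / real m ^ l"
      unfolding falling_factorial by (simp add: prod_dividef)
    finally show ?case by simp
  qed
  ultimately show ?thesis by (simp add: filterlim_cong tendsto_cong)
qed

text \<open>The error comes from the tuples with a repetition: on injective tuples, the product of
  kernel values is the indicator of an embedding, and on all others it lies between \<open>0\<close> and \<open>1\<close>.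
  The bound depends on the tournament \<open>(V, A)\<close> only through its number of vertices.\<close>
lemma tdensity_near_hom_density:
  fixes V W :: "nat set"
  assumes W: "tournament W B" and V: "tournament V A" "card W \<le> card V" "V \<noteq> {}"
  shows "\<bar>tdensity (tclass_of W B) (tclass_of V A) -
      fact (card W) / num_auts (tclass_of W B) * tournament_kernel.hom_density V (arc_kernel A) W B\<bar>
    \<le> fact (card W) * (1 - fact (card W) * (card V choose card W) / real (card V) ^ card W)"
proof -
  interpret tournament_kernel V "arc_kernel A"
    by (rule tournament_kernel_arc_kernel[OF V(1,3)])
  have fin: "finite W" "finite V" using W V by (auto simp: tournament_def)
  let ?inj = "{f \<in> W \<rightarrow>\<^sub>E V. inj_on f W}"
  let ?P = "\<lambda>f. \<Prod>(i, j)\<in>B. arc_kernel A (f i) (f j)"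
  define e where "e = real (card (embeddings W B V A))"
  define n where "n = real (card ?inj)"
  define M where "M = real (card V) ^ card W"
  \<comment> \<open>\<open>e\<close> of the \<open>n\<close> injective tuples are embeddings; the other \<open>M - n\<close> tuples have total weight \<open>r\<close>.\<close>
  define r where "r = (\<Sum>f\<in>(W \<rightarrow>\<^sub>E V) - ?inj. ?P f)"
  have M: "M = real (card (W \<rightarrow>\<^sub>E V))" using fin by (simp add: M_def card_PiE)
  have finE: "finite (W \<rightarrow>\<^sub>E V)" using fin by (simp add: finite_PiE)
  have B: "B \<subseteq> W \<times> W" "finite B"
    using W fin by (auto simp: tournament_def intro: finite_subset)
  have P: "0 \<le> ?P f \<and> ?P f \<le> 1" if "f \<in> W \<rightarrow>\<^sub>E V" for f
    using arc_product_bounds[OF B(1), of f] that by (auto simp: arc_product_def)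
  have inj_card: "n = fact (card W) * (card V choose card W)"
    using card_injections[OF fin] by (simp add: n_def)
  then have n: "0 < n" using V(2) by simp
  have nM: "n \<le> M" unfolding n_def M by (intro of_nat_mono card_mono finE) auto
  have en: "0 \<le> e" "e \<le> n"
    unfolding e_def n_def using finE by (auto simp: embeddings_def intro!: card_mono)
  have "(\<Sum>f\<in>?inj. ?P f) = (\<Sum>f\<in>?inj. of_bool (\<forall>(i, j)\<in>B. (f i, f j) \<in> A))"
  proof (rule sum.cong[OF refl])
    fix f assume f: "f \<in> ?inj"
    have "?P f = (\<Prod>(i, j)\<in>B. of_bool ((f i, f j) \<in> A))"
    proof (rule prod.cong[OF refl], clarify)
      fix i j assume "(i, j) \<in> B"
      then have "i \<in> W" "j \<in> W" "i \<noteq> j"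
        using W by (auto simp: tournament_alt)
      then have "f i \<noteq> f j"
        using f by (auto simp: inj_on_eq_iff)
      then show "arc_kernel A (f i) (f j) = of_bool ((f i, f j) \<in> A)"
        by (simp add: arc_kernel_def)
    qed
    also have "\<dots> = of_bool (\<forall>(i, j)\<in>B. (f i, f j) \<in> A)"
      using B(2) by (auto simp: case_prod_unfold prod_zero_iff)
    finally show "?P f = of_bool (\<forall>(i, j)\<in>B. (f i, f j) \<in> A)" .
  qed
  also have "\<dots> = e"
    unfolding e_def embeddings_def using finE
    by (subst sum_of_bool_eq) (auto intro: arg_cong[where f = card])
  finally have "(\<Sum>f\<in>W \<rightarrow>\<^sub>E V. ?P f) = r + e"
    unfolding r_def using sum.subset_diff[of ?inj "W \<rightarrow>\<^sub>E V" ?P] finE by auto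
  then have hom: "hom_density W B = (r + e) / M"
    by (simp add: hom_density_def tuple_avg_def M_def)
  have "0 \<le> r" unfolding r_def using P by (intro sum_nonneg) auto
  moreover have "r \<le> M - n"
  proof -
    have "r \<le> (\<Sum>f\<in>(W \<rightarrow>\<^sub>E V) - ?inj. 1)" unfolding r_def using P by (intro sum_mono) auto
    also have "\<dots> = M - n"
      unfolding M n_def using finE by (simp add: card_Diff_subset of_nat_diff card_mono)
    finally show ?thesis .
  qed
  ultimately have r: "0 \<le> r" "r \<le> M - n" .
  have M0: "0 < M" using n nM by linarith
  have diff: "\<bar>e / n - (r + e) / M\<bar> \<le> 1 - n / M"
  proof -
    have "e / n * ((M - n) / M) \<le> 1 * ((M - n) / M)"
      using en n nM M0 by (intro mult_right_mono) auto
    moreover have "e / n * ((M - n) / M) = e / n - e / M" "(M - n) / M = 1 - n / M"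
      using n M0 by (simp_all add: field_simps)
    moreover have "0 \<le> e / n * ((M - n) / M)" using en n nM M0 by simp
    moreover have "r / M \<le> (M - n) / M" "0 \<le> r / M" using r M0 by (auto intro: divide_right_mono)
    ultimately show ?thesis by (simp add: add_divide_distrib abs_le_iff)
  qed
  let ?au = "real (num_auts (tclass_of W B))"
  have au: "1 \<le> ?au" using num_auts_pos[of "tclass_of W B"] by linarith
  have "tdensity (tclass_of W B) (tclass_of V A) =
      real (card {S. S \<subseteq> V \<and> card S = card W \<and> induced A S = tclass_of W B}) /
      (card V choose card W)"
    unfolding tdensity_tclass_of[OF V(1)] num_verts_tclass_of[OF W] using fin by (simp add: n_subsets)
  also have "\<dots> = fact (card W) / ?au * (e / n)"
    unfolding e_def card_embeddings[OF W V(1)] inj_card using au V(2) by simp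
  finally have "\<bar>tdensity (tclass_of W B) (tclass_of V A) - fact (card W) / ?au * hom_density W B\<bar> =
      \<bar>fact (card W) / ?au\<bar> * \<bar>e / n - (r + e) / M\<bar>"
    by (simp only: hom right_diff_distrib[symmetric] abs_mult)
  also have "\<dots> \<le> fact (card W) * (1 - n / M)"
    using au diff by (intro mult_mono) (auto simp: divide_le_eq)
  finally show ?thesis by (simp add: inj_card M_def)
qed

section \<open>The transitive tournament and its automorphisms\<close>

definition forward_arcs :: "nat \<Rightarrow> (nat \<times> nat) set" where
  "forward_arcs k = {(i, j). i < j \<and> j < k}"

lemma tournament_forward_arcs: "tournament {..<k} (forward_arcs k)"
  by (auto simp: tournament_alt forward_arcs_def)

lemma tclass_of_forward_arcs: "tclass_of {..<k} (forward_arcs k) = transitive_tclass k"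
proof -
  have "bij_betw Suc {..<k} {1..k}"
    by (simp add: bij_betw_def image_Suc_lessThan)
  then have "tournament_iso Suc ({..<k}, forward_arcs k)
      ({1..k}, {(i, j). i \<in> {1..k} \<and> j \<in> {1..k} \<and> i < j})"
    by (auto simp: tournament_iso_def forward_arcs_def)
  then show ?thesis
    unfolding transitive_tclass_def
    using tclass_of_eq_iff[OF tournament_forward_arcs tournament_transitive] by blast
qed

lemma forward_arcs_iso_increasing:
  assumes "tournament_iso f ({..<k}, forward_arcs k) ({..<k}, forward_arcs k)" "i < k"
  shows "i \<le> f i"
  using assms(2)
proof (induction i)
  case (Suc i)
  then have "(i, Suc i) \<in> forward_arcs k" by (simp add: forward_arcs_def)
  then have "(f i, f (Suc i)) \<in> forward_arcs k"
    using assms(1) Suc.prems by (simp add: tournament_iso_def)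
  then show ?case using Suc by (simp add: forward_arcs_def)
qed simp

text \<open>An automorphism \<open>f\<close> is strictly increasing, hence \<open>i \<le> f i\<close>; the same holds for its inverse.\<close>
lemma num_auts_transitive: "num_auts (transitive_tclass k) = 1"
proof -
  let ?G = "({..<k}, forward_arcs k)"
  have "f = restrict id {..<k}" if "f \<in> tournament_isos ?G ?G" for f
  proof
    fix i
    have ext: "f \<in> extensional {..<k}" and iso: "tournament_iso f ?G ?G"
      using that by (auto simp: tournament_isos_def)
    then have bij: "bij_betw f {..<k} {..<k}" by (simp add: tournament_iso_def)
    show "f i = restrict id {..<k} i"
    proof (cases "i < k")
      case True
      then have "f i < k" using bij by (auto simp: bij_betw_def)
      then have "f i \<le> inv_into {..<k} f (f i)"
        by (rule forward_arcs_iso_increasing[OF tournament_iso_sym[OF iso]])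
      then show ?thesis
        using forward_arcs_iso_increasing[OF iso True] bij_betw_inv_into_left[OF bij] True by simp
    qed (use extensional_arb[OF ext] in simp)
  qed
  moreover have "restrict id {..<k} \<in> tournament_isos ?G ?G"
    by (simp add: tournament_isos_def tournament_iso_id)
  ultimately have "tournament_isos ?G ?G = {restrict id {..<k}}" by blast
  then show ?thesis
    unfolding tclass_of_forward_arcs[symmetric] num_auts_tclass_of[OF tournament_forward_arcs] by simp
qed

lemma card_arcs:
  assumes "tournament V A"
  shows "card A = card V choose 2"
proof -
  have V: "finite V" and "finite A"
    using assms by (auto simp: tournament_def intro: finite_subset)
  have arcs: "A \<subseteq> V \<times> V" "\<And>u v. (u, v) \<in> A \<Longrightarrow> (v, u) \<notin> A"
    "\<And>u v. u \<in> V \<Longrightarrow> v \<in> V \<Longrightarrow> u \<noteq> v \<Longrightarrow> (u, v) \<in> A \<or> (v, u) \<in> A"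
    using assms by (auto simp: tournament_alt)
  have "V \<times> V = A \<union> A\<inverse> \<union> Id_on V"
    using arcs(1) by (auto simp: Id_on_def dest: arcs(3))
  moreover have "A \<inter> A\<inverse> = {}" "(A \<union> A\<inverse>) \<inter> Id_on V = {}"
    using arcs(2) by (auto simp: Id_on_def)
  moreover have "finite (A\<inverse>)" "finite (Id_on V)" "card (A\<inverse>) = card A"
    using V \<open>finite A\<close> by (auto simp: Id_on_def)
  ultimately have "card V * card V = card A + card A + card (Id_on V)"
    using \<open>finite A\<close> by (simp add: card_cartesian_product[symmetric] card_Un_disjoint)
  moreover have "card (Id_on V) = card V"
    unfolding Id_on_def using V by (subst card_UN_disjoint) auto
  ultimately have "2 * card A = card V * (card V - 1)" by (simp add: diff_mult_distrib2)
  then show ?thesis by (simp add: choose_two)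
qed

section \<open>Positive homomorphisms as means over finite tournaments\<close>

definition representative_arcs :: "tclass \<Rightarrow> (nat \<times> nat) set" where
  "representative_arcs N =
     (SOME A. tournament {..<num_verts N} A \<and> N = tclass_of {..<num_verts N} A)"

lemma representative_arcs:
  "tournament {..<num_verts N} (representative_arcs N)"
  "tclass_of {..<num_verts N} (representative_arcs N) = N"
proof -
  have "\<exists>A. tournament {..<num_verts N} A \<and> N = tclass_of {..<num_verts N} A"
    using tclass_on[of "{..<num_verts N}" N] by force
  from someI_ex[OF this] show "tournament {..<num_verts N} (representative_arcs N)"
    "tclass_of {..<num_verts N} (representative_arcs N) = N"
    by (simp_all add: representative_arcs_def)
qed

text \<open>Fixing a representative of each class makes the kernel density a function of the class, as the
  means over classes require.\<close>
definition kernel_density :: "nat \<Rightarrow> (nat \<times> nat) set \<Rightarrow> tclass \<Rightarrow> real" where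
  "kernel_density l B N = tournament_kernel.hom_density {..<num_verts N}
     (arc_kernel (representative_arcs N)) {..<l} B"

lemma tournament_kernel_representative:
  "0 < num_verts N \<Longrightarrow> tournament_kernel {..<num_verts N} (arc_kernel (representative_arcs N))"
  by (rule tournament_kernel_arc_kernel[OF representative_arcs(1)]) auto

lemma kernel_density_transitive_ge:
  assumes "0 < num_verts N"
  shows "1 / 2 ^ (k choose 2) \<le> kernel_density k (forward_arcs k) N"
proof -
  interpret tournament_kernel "{..<num_verts N}" "arc_kernel (representative_arcs N)"
    by (rule tournament_kernel_representative[OF assms])
  show ?thesis
    using normalized_density_ge_1[of k]
    by (simp add: normalized_density_def transitive_density_eq_hom_density kernel_density_def
        forward_arcs_def field_simps)
qed

lemma kernel_density_near_quasirandom: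
  assumes "0 < num_verts N" "tournament {..<l} B" "0 < r" "4 \<le> k"
  shows "\<bar>kernel_density l B N - 1 / 2 ^ (l choose 2)\<bar> \<le> (l choose 2) *
    (r + 3 / 16 * (2 ^ (k choose 2) * kernel_density k (forward_arcs k) N - 1) / r ^ 3)"
proof -
  interpret tournament_kernel "{..<num_verts N}" "arc_kernel (representative_arcs N)"
    by (rule tournament_kernel_representative[OF assms(1)])
  have "B \<subseteq> {..<l} \<times> {..<l}" "asym B" "card B = l choose 2"
    using assms(2) card_arcs[OF assms(2)] by (auto simp: tournament_def)
  then show ?thesis
    using hom_density_near_quasirandom_of_transitive_density[of "{..<l}" B r k] assms(3,4)
    by (simp add: normalized_density_def transitive_density_eq_hom_density kernel_density_def
        forward_arcs_def)
qed

text \<open>The weights \<open>\<phi>(N)\<close> are nonnegative and add up to \<open>1\<close> if \<open>\<phi>\<close> is a positive homomorphism; see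
  \<open>mean_const\<close> and \<open>mean_mono\<close>.\<close>
definition mean :: "(flag_algebra \<Rightarrow> real) \<Rightarrow> nat \<Rightarrow> (tclass \<Rightarrow> real) \<Rightarrow> real" where
  "mean \<phi> m f = (\<Sum>N\<in>tclasses m. \<phi> (flag N) * f N)"

lemma Hom_plus_flag_eq_mean:
  assumes "\<phi> \<in> Hom_plus" "num_verts T \<le> m"
  shows "\<phi> (flag T) = mean \<phi> m (tdensity T)"
proof -
  interpret linear \<phi> using assms(1) by (simp add: Hom_plus_def)
  show ?thesis by (simp add: flag_expand[OF assms(2)] mean_def sum scale mult.commute)
qed

lemma tdensity_empty: "tdensity empty_tclass N = 1"
proof -
  obtain V A where VA: "tournament V A" "N = tclass_of V A" by (rule tclass_cases)
  then have "S \<subseteq> V \<and> card S = 0 \<longleftrightarrow> S = {}" for S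
    by (auto simp: tournament_def dest: finite_subset)
  then show ?thesis
    unfolding VA(2) tdensity_tclass_of[OF VA(1)] num_verts_empty
    by (simp add: induced_empty conj_assoc[symmetric] cong: conj_cong)
qed

lemma mean_const:
  assumes "\<phi> \<in> Hom_plus"
  shows "mean \<phi> m (\<lambda>_. c) = c"
proof -
  have "mean \<phi> m (\<lambda>_. 1) = \<phi> (flag empty_tclass)"
    using Hom_plus_flag_eq_mean[OF assms, of empty_tclass m]
    by (simp add: num_verts_empty tdensity_empty[abs_def])
  then have "(\<Sum>N\<in>tclasses m. \<phi> (flag N)) = 1"
    using assms by (simp add: flag_empty Hom_plus_def mean_def)
  then show ?thesis by (simp add: mean_def sum_distrib_right[symmetric])
qed

lemma mean_add: "mean \<phi> m (\<lambda>N. f N + g N) = mean \<phi> m f + mean \<phi> m g"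
  by (simp add: mean_def distrib_left sum.distrib)

lemma mean_diff: "mean \<phi> m (\<lambda>N. f N - g N) = mean \<phi> m f - mean \<phi> m g"
  by (simp add: mean_def right_diff_distrib sum_subtractf)

lemma mean_mult: "mean \<phi> m (\<lambda>N. c * f N) = c * mean \<phi> m f"
  by (simp add: mean_def sum_distrib_left mult_ac)

lemma mean_mono:
  assumes "\<phi> \<in> Hom_plus" "\<And>N. num_verts N = m \<Longrightarrow> f N \<le> g N"
  shows "mean \<phi> m f \<le> mean \<phi> m g"
  unfolding mean_def
  using assms by (intro sum_mono mult_left_mono) (auto simp: Hom_plus_def tclasses_def)

lemma abs_mean_le:
  assumes "\<phi> \<in> Hom_plus" "\<And>N. num_verts N = m \<Longrightarrow> \<bar>f N\<bar> \<le> g N"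
  shows "\<bar>mean \<phi> m f\<bar> \<le> mean \<phi> m g"
proof -
  have "mean \<phi> m f \<le> mean \<phi> m g" "mean \<phi> m (\<lambda>N. (- 1) * f N) \<le> mean \<phi> m g"
    using assms(2) by (intro mean_mono[OF assms(1)]; fastforce simp: abs_le_iff)+
  then show ?thesis unfolding mean_mult by simp
qed

text \<open>The mean of subtournament densities is exactly \<open>\<phi>(T)\<close> as soon as \<open>m \<ge> l\<close>; the errors made by
  passing to kernel densities vanish uniformly as \<open>m\<close> grows.\<close>
lemma mean_kernel_density_tendsto:
  assumes \<phi>: "\<phi> \<in> Hom_plus" and B: "tournament {..<l} B"
  shows "(\<lambda>m. mean \<phi> m (kernel_density l B)) \<longlonglongrightarrow>
    num_auts (tclass_of {..<l} B) / fact l * \<phi> (flag (tclass_of {..<l} B))"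
proof -
  let ?T = "tclass_of {..<l} B"
  let ?c = "fact l / real (num_auts ?T)"
  have c: "?c \<noteq> 0" using num_auts_pos[of ?T] by simp
  have nT: "num_verts ?T = l" using num_verts_tclass_of[OF B] by simp
  let ?e = "\<lambda>m. fact l * (1 - fact l * (m choose l) / real m ^ l)"
  have "(\<lambda>m. \<phi> (flag ?T) - ?c * mean \<phi> m (kernel_density l B)) \<longlonglongrightarrow> 0"
  proof (rule Lim_null_comparison)
    show "\<forall>\<^sub>F m in sequentially. norm (\<phi> (flag ?T) - ?c * mean \<phi> m (kernel_density l B)) \<le> ?e m"
      using eventually_ge_at_top[of "max l 1"]
    proof eventually_elim
      case (elim m)
      have "\<phi> (flag ?T) - ?c * mean \<phi> m (kernel_density l B) =
          mean \<phi> m (\<lambda>N. tdensity ?T N - ?c * kernel_density l B N)"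
        unfolding mean_diff mean_mult using Hom_plus_flag_eq_mean[OF \<phi>, of ?T m] elim
        by (simp add: nT)
      also have "\<bar>\<dots>\<bar> \<le> mean \<phi> m (\<lambda>_. ?e m)"
      proof (rule abs_mean_le[OF \<phi>])
        fix N assume N: "num_verts N = m"
        then show "\<bar>tdensity ?T N - ?c * kernel_density l B N\<bar> \<le> ?e m"
          using tdensity_near_hom_density[OF B representative_arcs(1)[of N]] elim
          by (auto simp: representative_arcs(2) kernel_density_def lessThan_empty_iff)
      qed
      finally show ?case by (simp add: mean_const[OF \<phi>])
    qed
    have "?e \<longlonglongrightarrow> fact l * (1 - 1)"
      by (intro tendsto_intros injective_ratio_tendsto_1)
    then show "?e \<longlonglongrightarrow> 0" by simp
  qed
  then have "(\<lambda>m. (\<phi> (flag ?T) - (\<phi> (flag ?T) - ?c * mean \<phi> m (kernel_density l B))) / ?c)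
      \<longlonglongrightarrow> (\<phi> (flag ?T) - 0) / ?c"
    using c by (intro tendsto_intros)
  then show ?thesis using c by (simp add: mult.commute)
qed

text \<open>Tournaments span the flag algebra.\<close>
lemma Hom_plus_eqI:
  assumes "\<phi> \<in> Hom_plus" "\<psi> \<in> Hom_plus" "\<And>T. \<phi> (flag T) = \<psi> (flag T)"
  shows "\<phi> = \<psi>"
proof
  fix x
  obtain y where y: "x = abs_flag_algebra y"
    using Quotient3_abs_rep[OF Quotient3_flag_algebra, of x] by metis
  have "linear (\<phi> \<circ> abs_flag_algebra)" "linear (\<psi> \<circ> abs_flag_algebra)"
    using assms(1,2) linear_lift_flag_algebra by (auto simp: Hom_plus_def intro: linear_compose)
  then have "(\<phi> \<circ> abs_flag_algebra) y = (\<psi> \<circ> abs_flag_algebra) y"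
    by (rule linear_eqI_basis_vec) (use assms(3) in \<open>simp add: flag.abs_eq\<close>)
  then show "\<phi> x = \<psi> x" by (simp add: y)
qed

lemma mean_transitive_tendsto:
  assumes "\<phi> \<in> Hom_plus"
  shows "(\<lambda>m. mean \<phi> m (kernel_density k (forward_arcs k))) \<longlonglongrightarrow>
    \<phi> (flag (transitive_tclass k)) / fact k"
  using mean_kernel_density_tendsto[OF assms tournament_forward_arcs[of k]]
  by (simp add: tclass_of_forward_arcs num_auts_transitive)

section \<open>The minimum density of transitive tournaments and where it is attained\<close>

lemma Hom_plus_transitive_ge:
  assumes "\<phi> \<in> Hom_plus"
  shows "fact k / 2 ^ (k choose 2) \<le> \<phi> (flag (transitive_tclass k))"
proof -
  have "1 / 2 ^ (k choose 2) \<le> \<phi> (flag (transitive_tclass k)) / fact k"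
  proof (rule tendsto_lowerbound[OF mean_transitive_tendsto[OF assms]])
    show "\<forall>\<^sub>F m in sequentially.
        1 / 2 ^ (k choose 2) \<le> mean \<phi> m (kernel_density k (forward_arcs k))"
      using eventually_gt_at_top[of 0]
    proof eventually_elim
      case (elim m)
      have "mean \<phi> m (\<lambda>_. 1 / 2 ^ (k choose 2)) \<le> mean \<phi> m (kernel_density k (forward_arcs k))"
        using elim by (intro mean_mono[OF assms] kernel_density_transitive_ge) simp
      then show ?case by (simp add: mean_const[OF assms])
    qed
  qed simp
  then show ?thesis by (simp add: field_simps)
qed

text \<open>For fixed \<open>r\<close>, the mean of the deviation from the quasi-random density is bounded in the limit by
  a multiple of \<open>r\<close>, since the term divided by \<open>r\<^sup>3\<close> tends to \<open>0\<close> by assumption.\<close>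
lemma Hom_plus_eq_phi_qr:
  assumes \<phi>: "\<phi> \<in> Hom_plus" and k: "4 \<le> k"
    and eq: "\<phi> (flag (transitive_tclass k)) = fact k / 2 ^ (k choose 2)"
  shows "\<phi> = phi_qr"
proof (rule Hom_plus_eqI[OF \<phi> phi_qr_in_Hom_plus])
  fix T
  define l where "l = num_verts T"
  obtain B where B: "tournament {..<l} B" "T = tclass_of {..<l} B"
    using representative_arcs[of T] unfolding l_def by metis
  define q where "q = 1 / (2::real) ^ (l choose 2)"
  define h where "h = num_auts T / fact l * \<phi> (flag T)"
  let ?n = "real (l choose 2)"
  let ?s = "\<lambda>m. mean \<phi> m (kernel_density k (forward_arcs k))"
  let ?t = "\<lambda>m. mean \<phi> m (kernel_density l B)"
  have t: "?t \<longlonglongrightarrow> h"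
    using mean_kernel_density_tendsto[OF \<phi> B(1)] by (simp add: h_def B(2))
  have s: "?s \<longlonglongrightarrow> 1 / 2 ^ (k choose 2)"
    using mean_transitive_tendsto[OF \<phi>, of k] by (simp add: eq)
  have bound: "\<bar>h - q\<bar> \<le> ?n * r" if r: "0 < r" for r
  proof -
    let ?b = "\<lambda>m. ?n * (r + 3 / 16 * (2 ^ (k choose 2) * ?s m - 1) / r ^ 3)"
    have t_lim: "(\<lambda>m. \<bar>?t m - q\<bar>) \<longlonglongrightarrow> \<bar>h - q\<bar>"
      by (intro tendsto_intros t)
    have b_lim: "?b \<longlonglongrightarrow> ?n * (r + 3 / 16 * (2 ^ (k choose 2) * (1 / 2 ^ (k choose 2)) - 1) / r ^ 3)"
      by (intro tendsto_intros s) (use r in simp)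
    have le: "\<forall>\<^sub>F m in sequentially. \<bar>?t m - q\<bar> \<le> ?b m"
      using eventually_gt_at_top[of 0]
    proof eventually_elim
      case (elim m)
      have "\<bar>?t m - q\<bar> = \<bar>mean \<phi> m (\<lambda>N. kernel_density l B N - q)\<bar>"
        by (simp add: mean_diff mean_const[OF \<phi>])
      also have "\<dots> \<le> mean \<phi> m (\<lambda>N. ?n *
          (r + 3 / 16 * (2 ^ (k choose 2) * kernel_density k (forward_arcs k) N - 1) / r ^ 3))"
        unfolding q_def
        using elim B(1) r k by (intro abs_mean_le[OF \<phi>] kernel_density_near_quasirandom) auto
      also have "\<dots> = mean \<phi> m (\<lambda>N. ?n * (r + 3 / 16 / r ^ 3 *
          (2 ^ (k choose 2) * kernel_density k (forward_arcs k) N - 1)))"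
        by simp
      also have "\<dots> = ?b m"
        unfolding mean_mult mean_add mean_diff mean_const[OF \<phi>] by simp
      finally show ?case .
    qed
    from tendsto_le[OF sequentially_bot b_lim t_lim le] show ?thesis by simp
  qed
  have "\<bar>h - q\<bar> \<le> 0 + e" if "0 < e" for e
  proof -
    \<comment> \<open>\<open>?n + 1\<close> instead of \<open>?n\<close>, which is \<open>0\<close> for tournaments with at most one vertex\<close>
    have "\<bar>h - q\<bar> \<le> ?n * (e / (?n + 1))" using that by (intro bound) simp
    also have "\<dots> \<le> e" using that by (simp add: field_simps)
    finally show ?thesis by simp
  qed
  then have "\<bar>h - q\<bar> \<le> 0" by (rule field_le_epsilon)
  then have "h = q" by simp
  then show "\<phi> (flag T) = phi_qr (flag T)"
    unfolding phi_qr_flag h_def q_def l_def[symmetric]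
    using num_auts_pos[of T] by (simp add: field_simps)
qed

theorem theorem2p1:
  fixes k :: nat and \<phi> :: "flag_algebra \<Rightarrow> real"
  assumes "\<phi> \<in> Hom_plus"
  shows "\<phi> (flag (transitive_tclass k)) \<ge> fact k / 2 ^ (k choose 2) \<and>
    (k \<ge> 4 \<longrightarrow>
      (\<phi> (flag (transitive_tclass k)) = fact k / 2 ^ (k choose 2) \<longleftrightarrow> \<phi> = phi_qr))"
proof -
  have "phi_qr (flag (transitive_tclass k)) = fact k / 2 ^ (k choose 2)"
    by (simp add: phi_qr_flag num_verts_transitive num_auts_transitive)
  then show ?thesis
    using Hom_plus_transitive_ge[OF assms, of k] Hom_plus_eq_phi_qr[OF assms, of k] by blast
qed

end
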